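(* Let $\lambda>\lambda_c$. If $\boldsymbol{Y}\sim\mathbb{P}_\lambda$, then $\frac1N\log L(\boldsymbol{Y};\lambda)>0$ with probability approaching one as $N\to\infty$. On the other hand, if $\boldsymbol{Y}\sim\mathbb{P}_0$, then $\frac1N\log L(\boldsymbol{Y};\lambda)\le0$ with probability approaching one as $N\to\infty$. Therefore $\mathbb{P}_\lambda$ and $\mathbb{P}_0$ are (asymptotically) mutually orthogonal above $\lambda_c$, i.e. there is a sequence of events $A_N$ with $\mathbb{P}_\lambda(A_N)\to1$ and $\mathbb{P}_0(A_N)\to0$.
   Context: Let $P_{\mathtt{x}}$ (the prior) be a probability distribution on $\mathbb{R}$ with bounded support. Spiked Wigner model with the diagonal discarded: for $\lambda\ge 0$ and $N\ge 1$, $\boldsymbol{Y}=\{Y_{ij}:1\le i<j\le N\}$ with $Y_{ij}=\sqrt{\lambda/N}\,x_i^*x_j^*+W_{ij}$, where $W_{ij}\sim\mathcal{N}(0,1)$ i.i.d., and $\boldsymbol{x}^*=(x_1^*,\dots,x_N^* )$ has i.i.d. coordinates from $P_{\mathtt{x}}$, independent of $\boldsymbol W$. $\mathbb{P}_\lambda$ denotes the law of $\boldsymbol{Y}$ (dependence on $N$ is suppressed). The likelihood ratio is $$L(\boldsymbol{Y};\lambda)=\frac{\mathrm{d}\mathbb{P}_\lambda}{\mathrm{d}\mathbb{P}_0}(\boldsymbol{Y})=\int\exp\Big(\sum_{i<j}\sqrt{\tfrac{\lambda}{N}}Y_{ij}x_ix_j-\tfrac{\lambda}{2N}x_i^2x_j^2\Big)\,\mathrm{d}P_{\mathtt{x}}^{\otimes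 N}(\boldsymbol{x}).$$ For $r\ge0$ let $\psi(r)=\mathbb{E}_{x^*,z}\log\int\exp\big(\sqrt r zx+rxx^*-\tfrac r2x^2\big)\mathrm{d}P_{\mathtt{x}}(x)$ with $z\sim\mathcal{N}(0,1)$ and $x^*\sim P_{\mathtt{x}}$ independent. Let $F(\lambda,q)=\psi(\lambda q)-\frac{\lambda q^2}{4}$ and $\phi_{\mathsf{RS}}(\lambda)=\sup_{q\ge0}F(\lambda,q)$. The reconstruction threshold is $\lambda_c=\sup\{\lambda>0:\phi_{\mathsf{RS}}(\lambda)=0\}$ (with $\sup\emptyset=0$). *)

theory Defs
  imports "HOL-Probability.Probability"
begin

definition measure_support :: "'a::topological_space measure \<Rightarrow> 'a set" where
  "measure_support M = {x. \<forall>U. open U \<and> x \<in> U \<longrightarrow> emeasure M U > 0}"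

definition pairs :: "nat \<Rightarrow> (nat \<times> nat) set" where
  "pairs N = {(i, j). 1 \<le> i \<and> i < j \<and> j \<le> N}"

abbreviation prior_power :: "real measure \<Rightarrow> nat \<Rightarrow> (nat \<Rightarrow> real) measure" where
  "prior_power P N \<equiv> PiM {1..N} (\<lambda>_. P)"

abbreviation noise :: "nat \<Rightarrow> (nat \<times> nat \<Rightarrow> real) measure" where
  "noise N \<equiv> PiM (pairs N) (\<lambda>_. std_normal_distribution)"

definition spiked_wigner :: "real measure \<Rightarrow> real \<Rightarrow> nat \<Rightarrow> (nat \<times> nat \<Rightarrow> real) measure" where
  "spiked_wigner P lam N =
     distr (prior_power P N \<Otimes>\<^sub>M noise N) (PiM (pairs N) (\<lambda>_. borel))
       (\<lambda>(x, W). \<lambda>(i, j)\<in>pairs N. sqrt (lam / real N) * x i * x j + W (i, j))"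

definition likelihood_ratio ::
    "real measure \<Rightarrow> real \<Rightarrow> nat \<Rightarrow> (nat \<times> nat \<Rightarrow> real) \<Rightarrow> real" where
  "likelihood_ratio P lam N Y =
     (\<integral>x. exp (\<Sum>(i, j)\<in>pairs N. sqrt (lam / real N) * Y (i, j) * x i * x j
                  - lam / (2 * real N) * (x i)\<^sup>2 * (x j)\<^sup>2) \<partial>prior_power P N)"

definition psi :: "real measure \<Rightarrow> real \<Rightarrow> real" where
  "psi P r =
     (\<integral>(xs, z). ln (\<integral>x. exp (sqrt r * z * x + r * x * xs - r / 2 * x\<^sup>2) \<partial>P)
        \<partial>(P \<Otimes>\<^sub>M std_normal_distribution))"

definition RS_potential :: "real measure \<Rightarrow> real \<Rightarrow> real \<Rightarrow> real" where
  "RS_potential P lam q = psi P (lam * q) - lam * q\<^sup>2 / 4"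

text \<open>Suprema are taken in the extended reals, so that they are genuine suprema even where a set
  is unbounded; in particular the threshold is infinite for a prior concentrated at \<open>0\<close>.\<close>

definition phi_RS :: "real measure \<Rightarrow> real \<Rightarrow> ereal" where
  "phi_RS P lam = (SUP q\<in>{0..}. ereal (RS_potential P lam q))"

text \<open>Inserting \<open>0\<close> gives the convention that the supremum of the empty set is \<open>0\<close>; it does not
  affect the supremum of a nonempty set of positive numbers.\<close>

definition lambda_c :: "real measure \<Rightarrow> ereal" where
  "lambda_c P = Sup (ereal ` insert 0 {lam. lam > 0 \<and> phi_RS P lam = 0})"

definition asymptotically_orthogonal ::
    "(nat \<Rightarrow> 'a measure) \<Rightarrow> (nat \<Rightarrow> 'a measure) \<Rightarrow> bool" where
  "asymptotically_orthogonal M M' \<longleftrightarrow>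
     (\<exists>A. (\<forall>N. A N \<in> sets (M N) \<and> A N \<in> sets (M' N)) \<and>
        (\<lambda>N. measure (M N) (A N)) \<longlonglongrightarrow> 1 \<and>
        (\<lambda>N. measure (M' N) (A N)) \<longlonglongrightarrow> 0)"

text \<open>The rest of the theory checks that \<open>likelihood_ratio\<close> is a density of
  \<open>spiked_wigner P lam N\<close> with respect to \<open>spiked_wigner P 0 N\<close>.\<close>

lemma finite_pairs [simp]: "finite (pairs N)"
  by (rule finite_subset[of _ "{1..N} \<times> {1..N}"]) (auto simp: pairs_def)

lemma pairs_bounds: "(i, j) \<in> pairs N \<Longrightarrow> i \<in> {1..N} \<and> j \<in> {1..N}"
  by (auto simp: pairs_def)

lemma prob_space_std_normal: "prob_space std_normal_distribution"
  by (rule prob_space_normal_density) simp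

lemma AE_measure_support:
  fixes M :: "'a::second_countable_topology measure"
  assumes sets: "sets M = sets borel"
  shows "AE x in M. x \<in> measure_support M"
proof -
  define F where "F = {U :: 'a set. open U \<and> emeasure M U = 0}"
  have compl: "- measure_support M = \<Union>F"
    unfolding F_def measure_support_def by (auto simp: zero_less_iff_neq_zero)
  obtain F' where F': "F' \<subseteq> F" "countable F'" "\<Union>F' = \<Union>F"
    using Lindelof[of F] unfolding F_def by auto
  have "\<Union>F' \<in> null_sets M"
  proof -
    have "(\<Union>U\<in>F'. U) \<in> null_sets M"
      using F'(1,2) by (intro null_sets_UN') (auto simp: F_def null_sets_def sets)
    then show ?thesis by simp
  qed
  then have "AE x in M. x \<notin> \<Union>F'" by (rule AE_not_in)
  then show ?thesis using F'(3) compl by (auto elim!: eventually_mono)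
qed

lemma std_normal_shift:
  fixes t :: real
  assumes [measurable]: "A \<in> sets borel"
  shows "(\<integral>\<^sup>+y. indicator A y * ennreal (exp (t * y - t\<^sup>2 / 2)) \<partial>std_normal_distribution)
       = emeasure std_normal_distribution ((\<lambda>w. t + w) -` A)"
proof -
  have dens: "std_normal_density y * exp (t * y - t\<^sup>2 / 2) = std_normal_density (y - t)" for y
    by (simp add: std_normal_density_def power2_eq_square field_simps flip: exp_add)
  have [measurable]: "(\<lambda>w. t + w) -` A \<in> sets borel"
    by (rule measurable_sets_borel[OF _ assms]) simp
  have "(\<integral>\<^sup>+y. indicator A y * ennreal (exp (t * y - t\<^sup>2 / 2)) \<partial>std_normal_distribution)
      = (\<integral>\<^sup>+y. ennreal (std_normal_density y) * (indicator A y * ennreal (exp (t * y - t\<^sup>2 / 2))) \<partial>lborel)"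
    by (subst nn_integral_density) auto
  also have "\<dots> = (\<integral>\<^sup>+y. ennreal (std_normal_density (y - t)) * indicator A y \<partial>lborel)"
    by (intro nn_integral_cong)
       (simp add: dens[symmetric] ennreal_mult' normal_density_nonneg mult_ac)
  also have "\<dots> = (\<integral>\<^sup>+y. ennreal (std_normal_density (y - t)) * indicator A y
                       \<partial>distr lborel borel (\<lambda>w. t + w))"
    by (simp add: lborel_distr_plus)
  also have "\<dots> = (\<integral>\<^sup>+w. ennreal (std_normal_density w) * indicator A (t + w) \<partial>lborel)"
    by (subst nn_integral_distr) auto
  also have "\<dots> = (\<integral>\<^sup>+w. ennreal (std_normal_density w) * indicator ((\<lambda>w. t + w) -` A) w \<partial>lborel)"
    by (intro nn_integral_cong) (simp add: indicator_def)
  also have "\<dots> = emeasure std_normal_distribution ((\<lambda>w. t + w) -` A)"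
    by (subst emeasure_density) auto
  finally show ?thesis .
qed

lemma noise_shift:
  fixes t :: "'i \<Rightarrow> real"
  assumes I [simp]: "finite I"
  shows "distr (PiM I (\<lambda>_. std_normal_distribution)) (PiM I (\<lambda>_. borel)) (\<lambda>W. \<lambda>e\<in>I. t e + W e)
       = density (PiM I (\<lambda>_. std_normal_distribution))
           (\<lambda>Y. ennreal (exp (\<Sum>e\<in>I. t e * Y e - (t e)\<^sup>2 / 2)))"
    (is "distr ?G ?B ?T = density ?G ?f")
proof -
  interpret S: prob_space std_normal_distribution by (rule prob_space_std_normal)
  interpret G: product_prob_space "\<lambda>_::'i. std_normal_distribution" I by standard
  have setsG: "sets ?G = sets ?B" by (intro sets_PiM_cong) auto
  have T [measurable]: "?T \<in> measurable ?G ?B"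
    by measurable
  have f [measurable]: "?f \<in> borel_measurable ?G"
    by measurable
  have dG: "emeasure (density ?G ?f) (PiE I A)
      = (\<Prod>e\<in>I. emeasure std_normal_distribution ((\<lambda>w. t e + w) -` A e))"
    if A: "\<And>e. e \<in> I \<Longrightarrow> A e \<in> sets borel" for A
  proof -
    have PA: "PiE I A \<in> sets ?G" using A by (intro sets_PiM_I_finite) auto
    have "emeasure (density ?G ?f) (PiE I A) = (\<integral>\<^sup>+Y. ?f Y * indicator (PiE I A) Y \<partial>?G)"
      using PA by (subst emeasure_density) auto
    also have "\<dots> = (\<integral>\<^sup>+Y. (\<Prod>e\<in>I. indicator (A e) (Y e)
                          * ennreal (exp (t e * Y e - (t e)\<^sup>2 / 2))) \<partial>?G)"
    proof (intro nn_integral_cong)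
      fix Y assume "Y \<in> space ?G"
      then have ext: "Y \<in> extensional I" by (auto simp: space_PiM PiE_def)
      have "indicator (PiE I A) Y = (\<Prod>e\<in>I. indicator (A e) (Y e) :: ennreal)"
      proof (cases "\<forall>e\<in>I. Y e \<in> A e")
        case True
        then show ?thesis using ext by (auto simp: PiE_def Pi_def)
      next
        case False
        then obtain e where "e \<in> I" "Y e \<notin> A e" by auto
        then have "(\<Prod>e\<in>I. indicator (A e) (Y e) :: ennreal) = 0"
          by (intro prod_zero bexI[of _ e]) auto
        moreover have "Y \<notin> PiE I A" using \<open>e \<in> I\<close> \<open>Y e \<notin> A e\<close> by auto
        ultimately show ?thesis by (metis indicator_simps(2))
      qed
      then show "?f Y * indicator (PiE I A) Y = (\<Prod>e\<in>I. indicator (A e) (Y e)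
                          * ennreal (exp (t e * Y e - (t e)\<^sup>2 / 2)))"
        by (simp add: exp_sum prod.distrib mult.commute flip: prod_ennreal)
    qed
    also have "\<dots> = (\<Prod>e\<in>I. \<integral>\<^sup>+y. indicator (A e) y * ennreal (exp (t e * y - (t e)\<^sup>2 / 2))
                          \<partial>std_normal_distribution)"
      using A by (intro G.product_nn_integral_prod) auto
    also have "\<dots> = (\<Prod>e\<in>I. emeasure std_normal_distribution ((\<lambda>w. t e + w) -` A e))"
      using A by (intro prod.cong refl std_normal_shift)
    finally show ?thesis .
  qed
  have dT: "emeasure (distr ?G ?B ?T) (PiE I A)
      = (\<Prod>e\<in>I. emeasure std_normal_distribution ((\<lambda>w. t e + w) -` A e))"
    if A: "\<And>e. e \<in> I \<Longrightarrow> A e \<in> sets borel" for A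
  proof -
    have PA: "PiE I A \<in> sets ?B" using A by (intro sets_PiM_I_finite) auto
    have *: "?T -` PiE I A \<inter> space ?G = PiE I (\<lambda>e. (\<lambda>w. t e + w) -` A e)"
      by (auto simp: space_PiM PiE_iff)
    have "(\<lambda>w. t e + w) -` A e \<in> sets borel" if "e \<in> I" for e
      by (rule measurable_sets_borel[OF _ A[OF that]]) simp
    then show ?thesis
      using PA by (simp add: emeasure_distr * G.emeasure_PiM)
  qed
  have fin: "finite_measure (distr ?G ?B ?T)"
    using G.prob_space_distr[OF T] by (simp add: prob_space_def)
  show ?thesis
  proof (rule measure_eqI_PiM_finite[of I _ "\<lambda>_. borel" _ "\<lambda>_::nat. PiE I (\<lambda>_. UNIV)"])
    show "sets (density ?G ?f) = sets ?B" using setsG by simp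
    show "range (\<lambda>_::nat. PiE I (\<lambda>_. UNIV)) \<subseteq> prod_algebra I (\<lambda>_. borel :: real measure)"
      by (auto intro!: prod_algebraI_finite)
    show "emeasure (distr ?G ?B ?T) (PiE I (\<lambda>_. UNIV)) \<noteq> \<infinity>"
      using finite_measure.emeasure_finite[OF fin] by simp
  qed (auto simp: dG dT space_PiM)
qed

lemma integrable_likelihood_ratio:
  assumes P: "real_distribution P" and bdd: "bounded (measure_support P)"
  shows "integrable (prior_power P N)
     (\<lambda>x. exp (\<Sum>(i, j)\<in>pairs N. sqrt (lam / real N) * Y (i, j) * x i * x j
                  - lam / (2 * real N) * (x i)\<^sup>2 * (x j)\<^sup>2))"
proof -
  interpret P: real_distribution P by (rule P)
  interpret Q: product_prob_space "\<lambda>_::nat. P" "{1..N}" by standard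
  obtain K where K: "\<And>x. x \<in> measure_support P \<Longrightarrow> \<bar>x\<bar> \<le> K"
    using bdd by (auto simp: bounded_iff)
  have "AE x in P. \<bar>x\<bar> \<le> K"
    using AE_measure_support[of P] K by (auto elim!: eventually_mono)
  then have "AE x in prior_power P N. \<bar>x i\<bar> \<le> K" if "i \<in> {1..N}" for i
    using that by (intro Q.AE_component) auto
  then have AE: "AE x in prior_power P N. \<forall>i\<in>{1..N}. \<bar>x i\<bar> \<le> K"
    by (subst AE_finite_all) auto
  define B where "B = (\<Sum>e\<in>pairs N. \<bar>sqrt (lam / real N) * Y e\<bar> * K * K + \<bar>lam / (2 * real N)\<bar> * K\<^sup>2 * K\<^sup>2)"
  have meas: "(\<lambda>x. exp (\<Sum>(i, j)\<in>pairs N. sqrt (lam / real N) * Y (i, j) * x i * x j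
                  - lam / (2 * real N) * (x i)\<^sup>2 * (x j)\<^sup>2)) \<in> borel_measurable (prior_power P N)"
    unfolding case_prod_beta
    by (intro borel_measurable_exp[THEN measurable_compose[rotated]] borel_measurable_sum
          borel_measurable_diff borel_measurable_times borel_measurable_const
          borel_measurable_power measurable_component_singleton[THEN measurable_compose]
          P.measurable_finite_borel) (auto dest: pairs_bounds)
  show ?thesis
  proof (rule Q.integrable_const_bound[where B = "exp B"])
    show "AE x in prior_power P N. norm (exp (\<Sum>(i, j)\<in>pairs N. sqrt (lam / real N) * Y (i, j) * x i * x j
                  - lam / (2 * real N) * (x i)\<^sup>2 * (x j)\<^sup>2)) \<le> exp B"
      using AE
    proof eventually_elim
      case (elim x)
      have "(case e of (i, j) \<Rightarrow> sqrt (lam / real N) * Y (i, j) * x i * x j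
                  - lam / (2 * real N) * (x i)\<^sup>2 * (x j)\<^sup>2)
          \<le> \<bar>sqrt (lam / real N) * Y e\<bar> * K * K + \<bar>lam / (2 * real N)\<bar> * K\<^sup>2 * K\<^sup>2" if e: "e \<in> pairs N" for e
      proof -
        obtain i j where ij: "e = (i, j)" by force
        have xi: "\<bar>x i\<bar> \<le> K" and xj: "\<bar>x j\<bar> \<le> K"
          using elim pairs_bounds[of i j N] e ij by auto
        have K0: "0 \<le> K" using xi by linarith
        have "sqrt (lam / real N) * Y (i, j) * x i * x j
            \<le> \<bar>sqrt (lam / real N) * Y (i, j)\<bar> * \<bar>x i\<bar> * \<bar>x j\<bar>"
          by (metis abs_ge_self abs_mult)
        also have "\<dots> \<le> \<bar>sqrt (lam / real N) * Y (i, j)\<bar> * K * K"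
          using xi xj K0 by (intro mult_mono) auto
        finally have 1: "sqrt (lam / real N) * Y (i, j) * x i * x j
            \<le> \<bar>sqrt (lam / real N) * Y (i, j)\<bar> * K * K" .
        have sq: "(x k)\<^sup>2 \<le> K\<^sup>2" if "\<bar>x k\<bar> \<le> K" for k
          using that K0 by (simp add: abs_le_square_iff[symmetric])
        have "- (lam / (2 * real N) * (x i)\<^sup>2 * (x j)\<^sup>2) \<le> \<bar>lam / (2 * real N) * (x i)\<^sup>2 * (x j)\<^sup>2\<bar>"
          by (rule abs_ge_minus_self)
        also have "\<dots> = \<bar>lam / (2 * real N)\<bar> * (x i)\<^sup>2 * (x j)\<^sup>2"
          by (simp only: abs_mult abs_power2)
        also have "\<dots> \<le> \<bar>lam / (2 * real N)\<bar> * K\<^sup>2 * K\<^sup>2"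
          using sq[OF xi] sq[OF xj] by (intro mult_mono) auto
        finally show ?thesis using 1 ij by simp
      qed
      then show ?case unfolding B_def by (simp add: sum_mono)
    qed
  qed (rule meas)
qed

proposition spiked_wigner_density:
  assumes P: "real_distribution P" and bdd: "bounded (measure_support P)" and lam: "0 \<le> lam"
  shows "spiked_wigner P lam N =
           density (spiked_wigner P 0 N) (\<lambda>Y. ennreal (likelihood_ratio P lam N Y))"
proof -
  interpret P: real_distribution P by (rule P)
  interpret S: prob_space std_normal_distribution by (rule prob_space_std_normal)
  interpret Q: product_prob_space "\<lambda>_::nat. P" "{1..N}" by standard
  interpret G: product_prob_space "\<lambda>_::nat \<times> nat. std_normal_distribution" "pairs N" by standard
  interpret QG: pair_prob_space "prior_power P N" "noise N" by standard
  let ?Q = "prior_power P N" and ?G = "noise N"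
  let ?B = "PiM (pairs N) (\<lambda>_. borel :: real measure)"
  define t where "t x e = sqrt (lam / real N) * x (fst e) * x (snd e)"
    for x :: "nat \<Rightarrow> real" and e :: "nat \<times> nat"
  define h where "h x Y = exp (\<Sum>e\<in>pairs N. t x e * Y e - (t x e)\<^sup>2 / 2)"
    for x :: "nat \<Rightarrow> real" and Y :: "nat \<times> nat \<Rightarrow> real"
  have xm: "(\<lambda>p. fst p i) \<in> borel_measurable (?Q \<Otimes>\<^sub>M ?G)" if "i \<in> {1..N}" for i
  proof -
    have "(\<lambda>x. x i) \<in> measurable ?Q P" using that by (rule measurable_component_singleton)
    then have "(\<lambda>x. x i) \<in> borel_measurable ?Q"
      by (subst measurable_cong_sets[OF refl P.events_eq_borel[symmetric]])
    then show ?thesis by (rule measurable_compose[OF measurable_fst])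
  qed
  have wm: "(\<lambda>p. snd p e) \<in> borel_measurable (?Q \<Otimes>\<^sub>M ?G)" if "e \<in> pairs N" for e
  proof -
    have "(\<lambda>x. x e) \<in> measurable ?G std_normal_distribution"
      using that by (rule measurable_component_singleton)
    then have "(\<lambda>x. x e) \<in> borel_measurable ?G" by (simp cong: measurable_cong_sets)
    then show ?thesis by (rule measurable_compose[OF measurable_snd])
  qed
  have tm: "(\<lambda>p. t (fst p) e) \<in> borel_measurable (?Q \<Otimes>\<^sub>M ?G)" if "e \<in> pairs N" for e
    unfolding t_def using that pairs_bounds[of "fst e" "snd e" N]
    by (intro borel_measurable_times borel_measurable_const xm) auto
  have hm: "(\<lambda>(x, Y). ennreal (h x Y)) \<in> borel_measurable (?Q \<Otimes>\<^sub>M ?G)"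
    unfolding h_def case_prod_beta
    by (intro measurable_compose[OF _ measurable_ennreal] measurable_compose[OF _ borel_measurable_exp]
          borel_measurable_sum borel_measurable_diff borel_measurable_times
          borel_measurable_divide borel_measurable_power borel_measurable_const tm wm)
  have Tm: "(\<lambda>(x, W). \<lambda>e\<in>pairs N. t x e + W e) \<in> measurable (?Q \<Otimes>\<^sub>M ?G) ?B"
    unfolding case_prod_beta
    by (intro measurable_restrict borel_measurable_add tm wm)
  have setsG: "sets ?G = sets ?B" by (intro sets_PiM_cong) auto
  have SW: "spiked_wigner P lam N = distr (?Q \<Otimes>\<^sub>M ?G) ?B (\<lambda>(x, W). \<lambda>e\<in>pairs N. t x e + W e)"
    unfolding spiked_wigner_def t_def
    by (intro distr_cong refl) (auto simp: restrict_def fun_eq_iff)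
  have zero: "spiked_wigner P 0 N = ?G"
  proof -
    have "spiked_wigner P 0 N = distr (?Q \<Otimes>\<^sub>M ?G) ?G snd"
      unfolding spiked_wigner_def
    proof (rule distr_cong[OF refl])
      fix p assume "p \<in> space (?Q \<Otimes>\<^sub>M ?G)"
      then have "snd p \<in> extensional (pairs N)"
        by (auto simp: space_pair_measure space_PiM PiE_def)
      then show "(case p of (x, W) \<Rightarrow> \<lambda>(i, j)\<in>pairs N. sqrt (0 / real N) * x i * x j + W (i, j)) = snd p"
        by (auto simp: fun_eq_iff case_prod_beta extensional_def restrict_def)
    qed (use setsG in simp)
    also have "\<dots> = ?G"
    proof (rule measure_eqI)
      fix A assume "A \<in> sets (distr (?Q \<Otimes>\<^sub>M ?G) ?G snd)"
      then have A: "A \<in> sets ?G" by simp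
      have "snd -` A \<inter> space (?Q \<Otimes>\<^sub>M ?G) = space ?Q \<times> A"
        using sets.sets_into_space[OF A] by (auto simp: space_pair_measure)
      then show "emeasure (distr (?Q \<Otimes>\<^sub>M ?G) ?G snd) A = emeasure ?G A"
        using A Q.emeasure_space_1 by (simp add: emeasure_distr G.emeasure_pair_measure_Times)
    qed simp
    finally show ?thesis .
  qed
  have L: "ennreal (likelihood_ratio P lam N Y) = (\<integral>\<^sup>+x. ennreal (h x Y) \<partial>?Q)" for Y
  proof -
    have h: "h x Y = exp (\<Sum>(i, j)\<in>pairs N. sqrt (lam / real N) * Y (i, j) * x i * x j
                  - lam / (2 * real N) * (x i)\<^sup>2 * (x j)\<^sup>2)" for x
      unfolding h_def t_def using lam
      by (intro arg_cong[where f = exp] sum.cong refl)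
         (auto simp: power_mult_distrib field_simps)
    have "integrable ?Q (\<lambda>x. h x Y)"
      unfolding h by (rule integrable_likelihood_ratio[OF P bdd])
    then have "(\<integral>\<^sup>+x. ennreal (h x Y) \<partial>?Q) = ennreal (\<integral>x. h x Y \<partial>?Q)"
      by (rule nn_integral_eq_integral) (auto simp: h_def)
    then show ?thesis by (simp add: likelihood_ratio_def h)
  qed
  have Lm: "(\<lambda>Y. ennreal (likelihood_ratio P lam N Y)) \<in> borel_measurable ?G"
    unfolding L using Q.borel_measurable_nn_integral[OF measurable_pair_swap[OF hm]] by simp
  show ?thesis
    unfolding zero
  proof (rule measure_eqI)
    show "sets (spiked_wigner P lam N) = sets (density ?G (\<lambda>Y. ennreal (likelihood_ratio P lam N Y)))"
      using setsG by (simp add: spiked_wigner_def)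
    fix A assume "A \<in> sets (spiked_wigner P lam N)"
    then have AB: "A \<in> sets ?B" by (simp add: spiked_wigner_def)
    then have A: "A \<in> sets ?G" using setsG by simp
    let ?T = "\<lambda>(x, W). \<lambda>e\<in>pairs N. t x e + W e"
    have Tx: "(\<lambda>W. \<lambda>e\<in>pairs N. t x e + W e) \<in> measurable ?G ?B" for x
      by measurable
    have hx: "(\<lambda>Y. ennreal (h x Y)) \<in> borel_measurable ?G" for x
      unfolding h_def by measurable
    have "emeasure (spiked_wigner P lam N) A = emeasure (?Q \<Otimes>\<^sub>M ?G) (?T -` A \<inter> space (?Q \<Otimes>\<^sub>M ?G))"
      unfolding SW by (rule emeasure_distr[OF Tm AB])
    also have "\<dots> = (\<integral>\<^sup>+x. emeasure ?G (Pair x -` (?T -` A \<inter> space (?Q \<Otimes>\<^sub>M ?G))) \<partial>?Q)"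
      by (rule G.emeasure_pair_measure_alt[OF measurable_sets[OF Tm AB]])
    also have "\<dots> = (\<integral>\<^sup>+x. (\<integral>\<^sup>+Y. ennreal (h x Y) * indicator A Y \<partial>?G) \<partial>?Q)"
    proof (intro nn_integral_cong)
      fix x assume x: "x \<in> space ?Q"
      have "Pair x -` (?T -` A \<inter> space (?Q \<Otimes>\<^sub>M ?G)) = (\<lambda>W. \<lambda>e\<in>pairs N. t x e + W e) -` A \<inter> space ?G"
        using x by (auto simp: space_pair_measure)
      then have "emeasure ?G (Pair x -` (?T -` A \<inter> space (?Q \<Otimes>\<^sub>M ?G)))
          = emeasure (distr ?G ?B (\<lambda>W. \<lambda>e\<in>pairs N. t x e + W e)) A"
        by (simp add: emeasure_distr[OF Tx AB])
      also have "\<dots> = emeasure (density ?G (\<lambda>Y. ennreal (h x Y))) A"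
        unfolding h_def by (simp add: noise_shift)
      also have "\<dots> = (\<integral>\<^sup>+Y. ennreal (h x Y) * indicator A Y \<partial>?G)"
        by (rule emeasure_density[OF hx A])
      finally show "emeasure ?G (Pair x -` (?T -` A \<inter> space (?Q \<Otimes>\<^sub>M ?G))) = \<dots>" .
    qed
    also have "\<dots> = (\<integral>\<^sup>+Y. (\<integral>\<^sup>+x. ennreal (h x Y) * indicator A Y \<partial>?Q) \<partial>?G)"
    proof (rule QG.Fubini'[symmetric])
      have "(\<lambda>p. (case p of (x, Y) \<Rightarrow> ennreal (h x Y)) * indicator A (snd p)) \<in> borel_measurable (?Q \<Otimes>\<^sub>M ?G)"
        by (intro borel_measurable_times_ennreal hm
              measurable_compose[OF measurable_snd borel_measurable_indicator[OF A]])
      then show "(\<lambda>(x, Y). ennreal (h x Y) * indicator A Y) \<in> borel_measurable (?Q \<Otimes>\<^sub>M ?G)"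
        by (simp add: case_prod_beta)
    qed
    also have "\<dots> = (\<integral>\<^sup>+Y. ennreal (likelihood_ratio P lam N Y) * indicator A Y \<partial>?G)"
    proof (intro nn_integral_cong)
      fix Y assume Y: "Y \<in> space ?G"
      have "(\<lambda>x. ennreal (h x Y)) \<in> borel_measurable ?Q"
        using measurable_compose[OF measurable_Pair2'[OF Y] hm] by simp
      then show "(\<integral>\<^sup>+x. ennreal (h x Y) * indicator A Y \<partial>?Q)
          = ennreal (likelihood_ratio P lam N Y) * indicator A Y"
        by (simp add: L nn_integral_multc)
    qed
    also have "\<dots> = emeasure (density ?G (\<lambda>Y. ennreal (likelihood_ratio P lam N Y))) A"
      by (rule emeasure_density[OF Lm A, symmetric])
    finally show "emeasure (spiked_wigner P lam N) A
        = emeasure (density ?G (\<lambda>Y. ennreal (likelihood_ratio P lam N Y))) A" .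
  qed
qed

end

theory Submission
  imports Defs
begin

text \<open>
  Fix \<open>u = 1 - s\<close> slightly below \<open>1\<close>. The likelihood ratio is a Gaussian partition function, and for
  fields with covariance kernels \<open>k \<ge> k'\<close> (pointwise, not only in the sense of quadratic forms) the
  fractional moment \<open>E Z\<^sup>u\<close> for \<open>k\<close> is at most the one for \<open>k'\<close>, because \<open>z \<mapsto> z\<^sup>u\<close> is concave (Kahane's
  comparison principle). With \<open>p\<^sub>i = x\<^sub>i x\<^sub>i'\<close>, completing the square in \<open>\<Sum>\<^sub>i p\<^sub>i\<close> gives
  \<open>(\<lambda>/N) \<Sum>\<^sub>i\<^sub><\<^sub>j p\<^sub>i p\<^sub>j + \<lambda>Nq\<^sup>2/2 + O(1) \<ge> \<lambda>q \<Sum>\<^sub>i p\<^sub>i\<close>, so under the null law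
  \<open>E L\<^sup>u \<le> O(1) (exp (s \<lambda> q\<^sup>2/4) E Z\<^sub>1\<^sup>u)\<^sup>N\<close>, where \<open>Z\<^sub>1\<close> is the likelihood ratio of the scalar channel with
  signal-to-noise ratio \<open>\<lambda>q\<close>. A change of measure gives \<open>E Z\<^sub>1\<^sup>u = exp (- s \<psi>(\<lambda>q) + O(s\<^sup>2))\<close>. Hence
  \<open>E L\<^sup>u\<close> is exponentially small as soon as \<open>F(\<lambda>, q) > 0\<close>, and Markov's inequality for \<open>L\<^bsup>-s\<^esup>\<close> under the
  spiked law shows that \<open>L \<ge> e\<^bsup>\<epsilon>N\<^esup>\<close> with high probability; no concentration inequality is needed.
  The null law is handled by splitting \<open>{L > 1}\<close> at \<open>L = e\<^bsup>\<epsilon>N\<^esup>\<close>: a change of measure bounds the lower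
  part, Markov's inequality the upper one.
\<close>

section \<open>Gaussian product measures\<close>

lemma distr_pair_snd:
  assumes "prob_space M" and "sigma_finite_measure N"
  shows "distr (M \<Otimes>\<^sub>M N) N snd = N"
proof -
  interpret M: prob_space M by (rule assms)
  interpret MN: pair_sigma_finite N M
    by (intro pair_sigma_finite.intro assms M.sigma_finite_measure_axioms)
  have "distr (M \<Otimes>\<^sub>M N) N snd = distr (distr (N \<Otimes>\<^sub>M M) (M \<Otimes>\<^sub>M N) (\<lambda>(x, y). (y, x))) N snd"
    using MN.distr_pair_swap pair_sigma_finite.distr_pair_swap[OF pair_sigma_finite.intro[OF M.sigma_finite_measure_axioms assms(2)]]
    by simp
  also have "\<dots> = distr (N \<Otimes>\<^sub>M M) N fst"
    by (subst distr_distr) (auto simp: comp_def split_beta)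
  finally show ?thesis by (simp add: M.distr_pair_fst)
qed

abbreviation gauss :: "'i set \<Rightarrow> ('i \<Rightarrow> real) measure" where
  "gauss I \<equiv> PiM I (\<lambda>_. std_normal_distribution)"

lemma prob_space_gauss: "prob_space (gauss I)"
  by (intro prob_space_PiM prob_space_std_normal)

lemma sets_gauss [measurable_cong]: "sets (gauss I) = sets (PiM I (\<lambda>_. borel))"
  by (intro sets_PiM_cong) auto

text \<open>By \<open>noise_shift\<close> the law of the noise translated by \<open>t\<close> has
  density \<open>exp (\<Sum>e\<in>I. t e * Y e - (t e)\<^sup>2 / 2)\<close>; that its total mass is
  one is the formula for the moment generating function.\<close>

lemma nn_integral_gauss_exp:
  assumes I: "finite I"
  shows "(\<integral>\<^sup>+Y. ennreal (exp (\<Sum>e\<in>I. t e * Y e)) \<partial>gauss I) = ennreal (exp (\<Sum>e\<in>I. (t e)\<^sup>2 / 2))"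
proof -
  let ?f = "\<lambda>Y. ennreal (exp (\<Sum>e\<in>I. t e * Y e - (t e)\<^sup>2 / 2))"
  interpret G: prob_space "gauss I" by (rule prob_space_gauss)
  have [measurable]: "(\<lambda>Y. \<lambda>e\<in>I. t e + Y e) \<in> measurable (gauss I) (PiM I (\<lambda>_. borel))"
    by measurable
  have "prob_space (distr (gauss I) (PiM I (\<lambda>_. borel)) (\<lambda>W. \<lambda>e\<in>I. t e + W e))"
    by (rule G.prob_space_distr) measurable
  then have "prob_space (density (gauss I) ?f)"
    by (simp add: noise_shift[OF I])
  then have "emeasure (density (gauss I) ?f) (space (gauss I)) = 1"
    using prob_space.emeasure_space_1 by fastforce
  moreover have "emeasure (density (gauss I) ?f) (space (gauss I)) = (\<integral>\<^sup>+Y. ?f Y \<partial>gauss I)"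
    by (subst emeasure_density) (auto intro!: nn_integral_cong)
  ultimately have 1: "(\<integral>\<^sup>+Y. ?f Y \<partial>gauss I) = 1" by simp
  have "(\<integral>\<^sup>+Y. ennreal (exp (\<Sum>e\<in>I. t e * Y e)) \<partial>gauss I)
      = (\<integral>\<^sup>+Y. ennreal (exp (\<Sum>e\<in>I. (t e)\<^sup>2 / 2)) * ?f Y \<partial>gauss I)"
    by (intro nn_integral_cong) (simp add: ennreal_mult'[symmetric] exp_add[symmetric] sum_subtractf)
  also have "\<dots> = ennreal (exp (\<Sum>e\<in>I. (t e)\<^sup>2 / 2)) * (\<integral>\<^sup>+Y. ?f Y \<partial>gauss I)"
    by (rule nn_integral_cmult) measurable
  finally show ?thesis using 1 by simp
qed

text \<open>Variances of independent Gaussians add. Characteristic functions cover the degenerate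
  case \<open>a = b = 0\<close>, where the law has no density, together with the others.\<close>

lemma std_normal_add_scaled:
  assumes a: "0 \<le> a" and b: "0 \<le> b"
  shows "distr (std_normal_distribution \<Otimes>\<^sub>M std_normal_distribution) borel
           (\<lambda>p. sqrt a * fst p + sqrt b * snd p)
       = distr std_normal_distribution borel (\<lambda>y. sqrt (a + b) * y)"
proof -
  interpret S: prob_space std_normal_distribution by (rule prob_space_std_normal)
  interpret SS: pair_prob_space std_normal_distribution std_normal_distribution by standard
  let ?S = std_normal_distribution
  let ?SS = "?S \<Otimes>\<^sub>M ?S"
  have c1: "char (distr ?S borel (\<lambda>y. c * y)) t = char ?S (c * t)" for c t
    by (simp add: char_def integral_distr mult_ac)
  have fst_law: "distr ?SS borel (\<lambda>p. c * fst p) = distr ?S borel (\<lambda>y. c * y)" for c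
  proof -
    have "distr ?S borel (\<lambda>y. c * y) = distr (distr ?SS ?S fst) borel (\<lambda>y. c * y)"
      by (simp add: S.distr_pair_fst)
    also have "\<dots> = distr ?SS borel (\<lambda>p. c * fst p)"
      by (subst distr_distr) (auto simp: comp_def)
    finally show ?thesis by simp
  qed
  have snd_law: "distr ?SS borel (\<lambda>p. c * snd p) = distr ?S borel (\<lambda>y. c * y)" for c
  proof -
    have "distr ?S borel (\<lambda>y. c * y) = distr (distr ?SS ?S snd) borel (\<lambda>y. c * y)"
      by (simp add: distr_pair_snd S.prob_space_axioms S.sigma_finite_measure_axioms)
    also have "\<dots> = distr ?SS borel (\<lambda>p. c * snd p)"
      by (subst distr_distr) (auto simp: comp_def)
    finally show ?thesis by simp
  qed
  have indep: "SS.indep_var borel (\<lambda>p. sqrt a * fst p) borel (\<lambda>p. sqrt b * snd p)"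
    unfolding SS.indep_var_distribution_eq
  proof (intro conjI)
    show "distr ?SS borel (\<lambda>p. sqrt a * fst p) \<Otimes>\<^sub>M distr ?SS borel (\<lambda>p. sqrt b * snd p)
        = distr ?SS (borel \<Otimes>\<^sub>M borel) (\<lambda>x. (sqrt a * fst x, sqrt b * snd x))"
      unfolding fst_law snd_law
      by (subst pair_measure_distr)
         (auto intro!: prob_space_imp_sigma_finite S.prob_space_distr distr_cong simp: split_beta)
  qed measurable
  have rd: "real_distribution (distr ?S borel (\<lambda>y. c * y))" for c
    by (intro S.real_distribution_distr) measurable
  show ?thesis
  proof (rule Levy_uniqueness)
    show "real_distribution (distr ?SS borel (\<lambda>p. sqrt a * fst p + sqrt b * snd p))"
      by (intro SS.real_distribution_distr) measurable
    show "char (distr ?SS borel (\<lambda>p. sqrt a * fst p + sqrt b * snd p))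
        = char (distr ?S borel (\<lambda>y. sqrt (a + b) * y))"
    proof
      fix t
      have "exp (- complex_of_real ((sqrt a * t)\<^sup>2) / 2) * exp (- complex_of_real ((sqrt b * t)\<^sup>2) / 2)
          = exp (- complex_of_real ((sqrt (a + b) * t)\<^sup>2) / 2)"
        using a b by (simp add: exp_add[symmetric] power_mult_distrib)
          (rule arg_cong[where f = exp], simp add: field_simps)
      then show "char (distr ?SS borel (\<lambda>p. sqrt a * fst p + sqrt b * snd p)) t
        = char (distr ?S borel (\<lambda>y. sqrt (a + b) * y)) t"
        using SS.char_distr_add[OF indep]
        by (simp add: fst_law snd_law c1 char_std_normal_distribution exp_of_real[symmetric])
    qed
  qed (rule rd)
qed

text \<open>Both laws factor over the coordinates, so they agree on boxes by the one-dimensional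
  case, and boxes determine a finite measure on a finite product.\<close>

lemma gauss_add_scaled:
  assumes I: "finite I" and a: "\<And>e. e \<in> I \<Longrightarrow> 0 \<le> a e" and b: "\<And>e. e \<in> I \<Longrightarrow> 0 \<le> b e"
  shows "distr (gauss I \<Otimes>\<^sub>M gauss I) (PiM I (\<lambda>_. borel))
           (\<lambda>p. \<lambda>e\<in>I. sqrt (a e) * fst p e + sqrt (b e) * snd p e)
       = distr (gauss I) (PiM I (\<lambda>_. borel)) (\<lambda>Y. \<lambda>e\<in>I. sqrt (a e + b e) * Y e)"
    (is "distr ?GG ?B ?S = distr ?G ?B ?T")
proof -
  interpret S: prob_space std_normal_distribution by (rule prob_space_std_normal)
  interpret G: product_prob_space "\<lambda>_::'a. std_normal_distribution" I by standard
  interpret GG: pair_prob_space ?G ?G by standard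
  interpret SS: pair_prob_space std_normal_distribution std_normal_distribution by standard
  have S [measurable]: "?S \<in> measurable ?GG ?B" by measurable
  have T [measurable]: "?T \<in> measurable ?G ?B" by measurable
  have rect: "emeasure (distr ?GG ?B ?S) (PiE I A) = emeasure (distr ?G ?B ?T) (PiE I A)"
    if A: "\<And>e. e \<in> I \<Longrightarrow> A e \<in> sets borel" for A
  proof -
    have PA [measurable]: "PiE I A \<in> sets ?B" using A by (intro sets_PiM_I_finite I) auto
    have A' [measurable]: "(\<lambda>w. sqrt (a e) * y + sqrt (b e) * w) -` A e \<in> sets borel"
      "(\<lambda>w. sqrt (a e + b e) * w) -` A e \<in> sets borel"
      "(\<lambda>p. sqrt (a e) * fst p + sqrt (b e) * snd p) -` A e \<in> sets (borel \<Otimes>\<^sub>M borel)"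
      if "e \<in> I" for e y
    proof -
      show "(\<lambda>w. sqrt (a e) * y + sqrt (b e) * w) -` A e \<in> sets borel"
        by (rule measurable_sets_borel[OF _ A[OF that]]) simp
      show "(\<lambda>w. sqrt (a e + b e) * w) -` A e \<in> sets borel"
        by (rule measurable_sets_borel[OF _ A[OF that]]) simp
      have "(\<lambda>p. sqrt (a e) * fst p + sqrt (b e) * snd p) -` A e \<inter> space (borel \<Otimes>\<^sub>M borel :: (real \<times> real) measure) \<in> sets (borel \<Otimes>\<^sub>M borel)"
        by (rule measurable_sets[OF _ A[OF that]]) measurable
      then show "(\<lambda>p. sqrt (a e) * fst p + sqrt (b e) * snd p) -` A e \<in> sets (borel \<Otimes>\<^sub>M borel)"
        by (simp add: space_pair_measure)
    qed
    have law: "(\<integral>\<^sup>+y. emeasure std_normal_distribution ((\<lambda>w. sqrt (a e) * y + sqrt (b e) * w) -` A e) \<partial>std_normal_distribution)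
        = emeasure std_normal_distribution ((\<lambda>w. sqrt (a e + b e) * w) -` A e)" if e: "e \<in> I" for e
    proof -
      have "emeasure std_normal_distribution ((\<lambda>w. sqrt (a e + b e) * w) -` A e)
          = emeasure (distr std_normal_distribution borel (\<lambda>w. sqrt (a e + b e) * w)) (A e)"
        using A[OF e] by (subst emeasure_distr) auto
      also have "\<dots> = emeasure (std_normal_distribution \<Otimes>\<^sub>M std_normal_distribution)
          ((\<lambda>p. sqrt (a e) * fst p + sqrt (b e) * snd p) -` A e)"
        using A[OF e] a[OF e] b[OF e]
        by (subst std_normal_add_scaled[symmetric]) (auto simp: emeasure_distr space_pair_measure)
      also have "\<dots> = (\<integral>\<^sup>+y. emeasure std_normal_distribution ((\<lambda>w. sqrt (a e) * y + sqrt (b e) * w) -` A e) \<partial>std_normal_distribution)"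
        by (subst S.emeasure_pair_measure_alt)
           (auto simp: vimage_def intro!: A'(3)[OF e, unfolded vimage_def] sets_pair_measure_cong[THEN equalityD2, THEN subsetD] nn_integral_cong)
      finally show ?thesis by simp
    qed
    have "emeasure (distr ?GG ?B ?S) (PiE I A) = emeasure ?GG (?S -` PiE I A \<inter> space ?GG)"
      by (rule emeasure_distr[OF S PA])
    also have "\<dots> = (\<integral>\<^sup>+Y. emeasure ?G (Pair Y -` (?S -` PiE I A \<inter> space ?GG)) \<partial>?G)"
      by (rule G.emeasure_pair_measure_alt[OF measurable_sets[OF S PA]])
    also have "\<dots> = (\<integral>\<^sup>+Y. (\<Prod>e\<in>I. emeasure std_normal_distribution ((\<lambda>w. sqrt (a e) * Y e + sqrt (b e) * w) -` A e)) \<partial>?G)"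
    proof (intro nn_integral_cong)
      fix Y assume Y: "Y \<in> space ?G"
      have "Pair Y -` (?S -` PiE I A \<inter> space ?GG) = PiE I (\<lambda>e. (\<lambda>w. sqrt (a e) * Y e + sqrt (b e) * w) -` A e)"
        using Y by (auto simp: space_pair_measure space_PiM PiE_iff)
      then show "emeasure ?G (Pair Y -` (?S -` PiE I A \<inter> space ?GG))
          = (\<Prod>e\<in>I. emeasure std_normal_distribution ((\<lambda>w. sqrt (a e) * Y e + sqrt (b e) * w) -` A e))"
        using A'(1) by (simp add: G.emeasure_PiM I)
    qed
    also have "\<dots> = (\<Prod>e\<in>I. \<integral>\<^sup>+y. emeasure std_normal_distribution ((\<lambda>w. sqrt (a e) * y + sqrt (b e) * w) -` A e) \<partial>std_normal_distribution)"
    proof (intro G.product_nn_integral_prod I)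
      fix e assume e: "e \<in> I"
      have "(\<lambda>y. emeasure std_normal_distribution (Pair y -` ((\<lambda>p. sqrt (a e) * fst p + sqrt (b e) * snd p) -` A e)))
          \<in> borel_measurable std_normal_distribution"
        by (rule S.measurable_emeasure_Pair)
           (use A'(3)[OF e] in \<open>auto intro!: sets_pair_measure_cong[THEN equalityD2, THEN subsetD]\<close>)
      then show "(\<lambda>y. emeasure std_normal_distribution ((\<lambda>w. sqrt (a e) * y + sqrt (b e) * w) -` A e))
          \<in> borel_measurable std_normal_distribution"
        by (simp add: vimage_def)
    qed
    also have "\<dots> = (\<Prod>e\<in>I. emeasure std_normal_distribution ((\<lambda>w. sqrt (a e + b e) * w) -` A e))"
      by (intro prod.cong refl law)
    also have "\<dots> = emeasure ?G (PiE I (\<lambda>e. (\<lambda>w. sqrt (a e + b e) * w) -` A e))"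
      using A'(2) by (simp add: G.emeasure_PiM I)
    also have "PiE I (\<lambda>e. (\<lambda>w. sqrt (a e + b e) * w) -` A e) = ?T -` PiE I A \<inter> space ?G"
      by (auto simp: space_PiM PiE_iff)
    also have "emeasure ?G \<dots> = emeasure (distr ?G ?B ?T) (PiE I A)"
      by (rule emeasure_distr[OF T PA, symmetric])
    finally show ?thesis .
  qed
  have fin: "finite_measure (distr ?GG ?B ?S)"
    using GG.prob_space_distr[OF S] by (simp add: prob_space_def)
  show ?thesis
  proof (rule measure_eqI_PiM_finite[of I _ "\<lambda>_. borel" _ "\<lambda>_::nat. PiE I (\<lambda>_. UNIV)"])
    show "range (\<lambda>_::nat. PiE I (\<lambda>_. UNIV)) \<subseteq> prod_algebra I (\<lambda>_. borel :: real measure)"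
      by (auto intro!: prod_algebraI_finite I)
    show "emeasure (distr ?GG ?B ?S) (PiE I (\<lambda>_. UNIV)) \<noteq> \<infinity>"
      using finite_measure.emeasure_finite[OF fin] by simp
  qed (auto simp: rect space_PiM I)
qed

text \<open>The iterated form allows the first Gaussian vector to be frozen while the integral over
  the second one is estimated.\<close>

lemma nn_integral_gauss_add_scaled:
  assumes I: "finite I" and a: "\<And>e. e \<in> I \<Longrightarrow> 0 \<le> a e" and b: "\<And>e. e \<in> I \<Longrightarrow> 0 \<le> b e"
    and f [measurable]: "f \<in> borel_measurable (PiM I (\<lambda>_. borel))"
  shows "(\<integral>\<^sup>+Y. f (\<lambda>e\<in>I. sqrt (a e + b e) * Y e) \<partial>gauss I)
       = (\<integral>\<^sup>+Y. (\<integral>\<^sup>+Y'. f (\<lambda>e\<in>I. sqrt (a e) * Y e + sqrt (b e) * Y' e) \<partial>gauss I) \<partial>gauss I)"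
proof -
  interpret G: prob_space "gauss I" by (rule prob_space_gauss)
  have "(\<integral>\<^sup>+Y. f (\<lambda>e\<in>I. sqrt (a e + b e) * Y e) \<partial>gauss I)
      = (\<integral>\<^sup>+Y. f Y \<partial>distr (gauss I) (PiM I (\<lambda>_. borel)) (\<lambda>Y. \<lambda>e\<in>I. sqrt (a e + b e) * Y e))"
    by (subst nn_integral_distr) auto
  also have "\<dots> = (\<integral>\<^sup>+p. f (\<lambda>e\<in>I. sqrt (a e) * fst p e + sqrt (b e) * snd p e) \<partial>(gauss I \<Otimes>\<^sub>M gauss I))"
    by (subst gauss_add_scaled[OF I a b, symmetric]) (auto simp: nn_integral_distr)
  also have "\<dots> = (\<integral>\<^sup>+Y. (\<integral>\<^sup>+Y'. f (\<lambda>e\<in>I. sqrt (a e) * Y e + sqrt (b e) * Y' e) \<partial>gauss I) \<partial>gauss I)"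
    by (subst G.nn_integral_fst[symmetric]) auto
  finally show ?thesis .
qed

section \<open>Fractional moments of Gaussian channels\<close>

text \<open>Taylor's theorem near \<open>w = 0\<close>, and crude bounds away from it, where the
  cube is not small. The constant is uniform in \<open>u\<close>; 24 comes from
  \<open>w < - 1 / 2\<close>, where the left side is at most 3 and \<open>\<bar>w\<bar> ^ 3\<close>
  is at least 1/8.\<close>

lemma one_plus_powr_second_order:
  fixes u w :: real
  assumes u: "0 < u" "u < 1" and w: "- 1 \<le> w"
  shows "\<bar>(1 + w) powr u - (1 + u * w - u * (1 - u) / 2 * w\<^sup>2)\<bar> \<le> 24 * \<bar>w\<bar> ^ 3"
proof -
  have uu: "0 \<le> u * (1 - u)" "u * (1 - u) \<le> 1"
    using u by (auto intro: mult_le_one)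
  have quad: "\<bar>u * (1 - u) / 2 * w\<^sup>2\<bar> \<le> w\<^sup>2 / 2"
    using mult_right_mono[OF uu(2), of "w\<^sup>2"] uu(1) by simp
  have lin: "\<bar>u * w\<bar> \<le> \<bar>w\<bar>"
    using u mult_right_mono[of u 1 "\<bar>w\<bar>"] by (simp add: abs_mult)
  consider "w = 0" | "w \<noteq> 0" "\<bar>w\<bar> \<le> 1 / 2" | "w < - 1 / 2" | "1 / 2 < w" by linarith
  then show ?thesis
  proof cases
    case 1
    then show ?thesis by simp
  next
    case 2
    \<comment> \<open>\<open>D m\<close> is the \<open>m\<close>-th derivative of
      \<open>t powr u\<close>, expanded around 1; \<open>D 3\<close> is bounded by 16 for arguments
      at least 1/2.\<close>
    define D where "D m t = (\<Prod>i<m. u - real i) * t powr (u - real m)" for m :: nat and t :: real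
    have "\<exists>t. (if 1 + w < 1 then 1 + w < t \<and> t < 1 else 1 < t \<and> t < 1 + w) \<and>
        (1 + w) powr u = (\<Sum>m<3. D m 1 / fact m * ((1 + w) - 1) ^ m) + D 3 t / fact 3 * ((1 + w) - 1) ^ 3"
    proof (rule Taylor[where a = "1/2" and b = 2])
      show "D 0 = (\<lambda>t. t powr u)" by (simp add: D_def fun_eq_iff)
      show "\<forall>m t. m < 3 \<and> 1 / 2 \<le> t \<and> t \<le> 2 \<longrightarrow> (D m has_real_derivative D (Suc m) t) (at t)"
      proof (intro allI impI)
        fix m :: nat and t :: real
        assume "m < 3 \<and> 1 / 2 \<le> t \<and> t \<le> 2"
        then have "0 < t" by linarith
        then show "(D m has_real_derivative D (Suc m) t) (at t)"
          unfolding D_def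
          by (auto intro!: derivative_eq_intros simp: algebra_simps)
      qed
    qed (use 2 in auto)
    then obtain t where t: "if 1 + w < 1 then 1 + w < t \<and> t < 1 else 1 < t \<and> t < 1 + w"
      and eq: "(1 + w) powr u = (\<Sum>m<3. D m 1 / fact m * w ^ m) + D 3 t / fact 3 * w ^ 3" by auto
    have t2: "1 / 2 \<le> t" using t 2 by (auto split: if_splits)
    have "t powr (u - 3) \<le> (1 / 2) powr (u - 3)"
      using t2 u by (intro powr_mono2') auto
    also have "\<dots> = 2 powr (3 - u)"
      by (simp add: powr_divide powr_minus[symmetric] powr_diff)
    also have "\<dots> \<le> 2 powr 3"
      using u by (intro powr_mono) auto
    finally have p: "t powr (u - 3) \<le> 8" by simp
    have "D 3 t = u * (1 - u) * (2 - u) * t powr (u - 3)"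
      by (simp add: D_def numeral_3_eq_3 algebra_simps)
    moreover have "u * (1 - u) * (2 - u) * t powr (u - 3) \<le> 1 * 2 * 8"
      using uu u p by (intro mult_mono) auto
    moreover have "0 \<le> u * (1 - u) * (2 - u) * t powr (u - 3)"
      using uu u by (intro mult_nonneg_nonneg) auto
    ultimately have D3: "\<bar>D 3 t\<bar> \<le> 16" by simp
    have "(1 + w) powr u - (1 + u * w - u * (1 - u) / 2 * w\<^sup>2) = D 3 t / 6 * w ^ 3"
      unfolding eq by (simp add: D_def numeral_3_eq_3 fact_reduce power2_eq_square field_simps)
    then have "\<bar>(1 + w) powr u - (1 + u * w - u * (1 - u) / 2 * w\<^sup>2)\<bar> = \<bar>D 3 t\<bar> / 6 * \<bar>w\<bar> ^ 3"
      by (simp only: abs_mult abs_divide power_abs abs_numeral)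
    also have "\<dots> \<le> 24 * \<bar>w\<bar> ^ 3"
      using D3 by (intro mult_right_mono) auto
    finally show ?thesis .
  next
    case 3
    have p: "0 \<le> (1 + w) powr u" "(1 + w) powr u \<le> 1"
      using u w 3 powr_le1[of u "1 + w"] by auto
    have w1: "\<bar>w\<bar> \<le> 1" "w\<^sup>2 \<le> 1"
      using w 3 by (auto simp: abs_square_le_1)
    have "(1 / 2) ^ 3 \<le> \<bar>w\<bar> ^ 3" using 3 by (intro power_mono) auto
    then have "3 \<le> 24 * \<bar>w\<bar> ^ 3" by (simp add: power3_eq_cube)
    then show ?thesis using p w1 quad lin by linarith
  next
    case 4
    have "1 \<le> (1 + w) powr u" using 4 u by (intro ge_one_powr_ge_zero) auto
    moreover have "(1 + w) powr u \<le> (1 + w) powr 1" using 4 u by (intro powr_mono) auto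
    ultimately have p: "1 \<le> (1 + w) powr u" "(1 + w) powr u \<le> 1 + w" using 4 by auto
    have "w * (1/2) \<le> w * w" using 4 by (intro mult_left_mono) auto
    then have w2: "w \<le> 2 * w\<^sup>2" by (simp add: power2_eq_square)
    have "w\<^sup>2 * (1/2) \<le> w\<^sup>2 * w" using 4 by (intro mult_left_mono) auto
    then have w3: "w\<^sup>2 \<le> 2 * \<bar>w\<bar> ^ 3" using 4 by (simp add: power2_eq_square power3_eq_cube)
    have "\<bar>(1 + w) powr u - (1 + u * w - u * (1 - u) / 2 * w\<^sup>2)\<bar> \<le> w + w + w\<^sup>2 / 2"
      using p quad lin 4 by linarith
    also have "\<dots> \<le> 5 * w\<^sup>2" using w2 zero_le_power2[of w] by linarith
    also have "\<dots> \<le> 24 * \<bar>w\<bar> ^ 3" using w3 zero_le_power[of "\<bar>w\<bar>" 3] by linarith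
    finally show ?thesis .
  qed
qed

text \<open>Expanding the square of \<open>\<bar>w\<bar> - r\<close> trades the odd power for the
  second and the fourth, whose moments are easier to control. The parameter \<open>r\<close> stays
  free in order to balance the two terms later.\<close>

lemma one_plus_powr_second_order':
  fixes u w r :: real
  assumes u: "0 < u" "u < 1" and w: "- 1 \<le> w" and r: "0 < r"
  shows "\<bar>(1 + w) powr u - (1 + u * w - u * (1 - u) / 2 * w\<^sup>2)\<bar> \<le> 12 * (r * w\<^sup>2 + w ^ 4 / r)"
proof -
  have "0 \<le> w\<^sup>2 / r * (\<bar>w\<bar> - r)\<^sup>2" using r by simp
  also have "\<dots> = r * w\<^sup>2 + w ^ 4 / r - 2 * \<bar>w\<bar> ^ 3"
    using r by (auto simp: field_simps power2_eq_square power3_eq_cube power4_eq_xxxx abs_if)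
  finally have "2 * \<bar>w\<bar> ^ 3 \<le> r * w\<^sup>2 + w ^ 4 / r" by simp
  then have "24 * \<bar>w\<bar> ^ 3 \<le> 12 * (r * w\<^sup>2 + w ^ 4 / r)" by argo
  then show ?thesis
    using one_plus_powr_second_order[OF u w] by (rule order_trans[rotated])
qed

text \<open>The terms of order 0 and 1 cancel, since 1 - 4 + 6 - 3 = 0 and 6 - 12 + 6 = 0. The
  quadratic upper bounds on the two positive exponentials leave 36 + 6 = 42.\<close>

lemma exp_fourth_difference:
  fixes x :: real
  assumes "0 \<le> x" "x \<le> 1 / 6"
  shows "exp (6 * x) - 4 * exp (3 * x) + 6 * exp x - 3 \<le> 42 * x\<^sup>2"
proof -
  have "exp (6 * x) \<le> 1 + 6 * x + (6 * x)\<^sup>2" "exp x \<le> 1 + x + x\<^sup>2"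
    using assms by (intro exp_bound; simp)+
  moreover have "(6 * x)\<^sup>2 = 36 * x\<^sup>2" by (simp add: power_mult_distrib)
  moreover have "1 + 3 * x \<le> exp (3 * x)" by (rule exp_ge_add_one_self)
  ultimately show ?thesis by linarith
qed

section \<open>Gaussian channels and the moments of their likelihood ratio\<close>

lemma has_bochner_integral_gauss_exp:
  assumes I: "finite I"
  shows "has_bochner_integral (gauss I) (\<lambda>Y. exp (\<Sum>e\<in>I. t e * Y e)) (exp (\<Sum>e\<in>I. (t e)\<^sup>2 / 2))"
  by (rule has_bochner_integral_nn_integral) (auto simp: nn_integral_gauss_exp[OF I])

text \<open>Density, relative to pure noise, of the observation with entries \<open>v e x\<close>
  plus noise, when the hidden state is \<open>x\<close>.\<close>

definition channel_weight :: "'i set \<Rightarrow> ('i \<Rightarrow> 'x \<Rightarrow> real) \<Rightarrow> 'x \<Rightarrow> ('i \<Rightarrow> real) \<Rightarrow> real" where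
  "channel_weight I v x Y = exp (\<Sum>e\<in>I. v e x * Y e - (v e x)\<^sup>2 / 2)"

text \<open>The likelihood ratio of the channel once the hidden state is averaged out, or a Gaussian
  partition function with reference measure \<open>M\<close>.\<close>

definition channel_ratio :: "'x measure \<Rightarrow> 'i set \<Rightarrow> ('i \<Rightarrow> 'x \<Rightarrow> real) \<Rightarrow> ('i \<Rightarrow> real) \<Rightarrow> real" where
  "channel_ratio M I v Y = (\<integral>x. channel_weight I v x Y \<partial>M)"

text \<open>Covariance of the Gaussian field \<open>\<Sum>e\<in>I. v e x * Y e\<close> that is
  indexed by the hidden state.\<close>

definition channel_kernel :: "'i set \<Rightarrow> ('i \<Rightarrow> 'x \<Rightarrow> real) \<Rightarrow> 'x \<Rightarrow> 'x \<Rightarrow> real" where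
  "channel_kernel I v x x' = (\<Sum>e\<in>I. v e x * v e x')"

lemma channel_weight_pos: "0 < channel_weight I v x Y"
  by (simp add: channel_weight_def)

lemma channel_weight_power:
  "channel_weight I v x Y ^ k
     = exp (- real k * channel_kernel I v x x / 2) * exp (\<Sum>e\<in>I. (real k * v e x) * Y e)"
  unfolding channel_weight_def channel_kernel_def
  by (simp add: exp_of_nat_mult[symmetric] exp_add[symmetric] sum_subtractf sum_divide_distrib[symmetric]
        sum_distrib_left power2_eq_square right_diff_distrib mult.assoc sum_negf)

text \<open>The normalisation contributes \<open>- k / 2\<close> and the Gaussian integral
  \<open>k * k / 2\<close> times the kernel, so the exponent is \<open>k choose 2\<close> times the
  kernel.\<close>

lemma channel_weight_power_integral:
  assumes I: "finite I"
  shows "has_bochner_integral (gauss I) (\<lambda>Y. channel_weight I v x Y ^ k)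
           (exp ((real k * real k - real k) / 2 * channel_kernel I v x x))"
proof -
  have "has_bochner_integral (gauss I) (\<lambda>Y. channel_weight I v x Y ^ k)
      (exp (- real k * channel_kernel I v x x / 2) * exp (\<Sum>e\<in>I. (real k * v e x)\<^sup>2 / 2))"
    unfolding channel_weight_power
    by (intro has_bochner_integral_mult_right has_bochner_integral_gauss_exp I)
  moreover have "(\<Sum>e\<in>I. (real k * v e x)\<^sup>2 / 2) = real k * real k / 2 * channel_kernel I v x x"
    unfolding channel_kernel_def sum_distrib_left
    by (intro sum.cong) (auto simp: power2_eq_square)
  moreover have "- real k * channel_kernel I v x x / 2 + real k * real k / 2 * channel_kernel I v x x
      = (real k * real k - real k) / 2 * channel_kernel I v x x"
    by (simp add: algebra_simps diff_divide_distrib)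
  ultimately show ?thesis
    by (simp only: exp_add[symmetric])
qed

text \<open>Binomial expansion: the powers 4, 3, 2, 1, 0 of the weight have exponents 6, 3, 1, 0, 0,
  and the last two terms combine to -3.\<close>

lemma channel_weight_fourth_moment:
  assumes I: "finite I"
  shows "has_bochner_integral (gauss I) (\<lambda>Y. (channel_weight I v x Y - 1) ^ 4)
     (exp (6 * channel_kernel I v x x) - 4 * exp (3 * channel_kernel I v x x)
        + 6 * exp (channel_kernel I v x x) - 3)"
proof -
  interpret G: prob_space "gauss I" by (rule prob_space_gauss)
  let ?w = "channel_weight I v x" and ?k = "channel_kernel I v x x"
  have 1: "has_bochner_integral (gauss I) (\<lambda>Y. 1 :: real) 1"
    by (simp add: has_bochner_integral_iff G.prob_space)
  have "has_bochner_integral (gauss I) (\<lambda>Y. ?w Y ^ 4 - 4 * ?w Y ^ 3 + 6 * ?w Y ^ 2 - 4 * ?w Y ^ 1 + 1)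
     (exp ((real 4 * real 4 - real 4) / 2 * ?k) - 4 * exp ((real 3 * real 3 - real 3) / 2 * ?k)
        + 6 * exp ((real 2 * real 2 - real 2) / 2 * ?k) - 4 * exp ((real 1 * real 1 - real 1) / 2 * ?k) + 1)"
    by (intro has_bochner_integral_add has_bochner_integral_diff has_bochner_integral_mult_right
          channel_weight_power_integral I 1)
  moreover have "?w Y ^ 4 - 4 * ?w Y ^ 3 + 6 * ?w Y ^ 2 - 4 * ?w Y ^ 1 + 1 = (?w Y - 1) ^ 4" for Y
    by (simp add: power4_eq_xxxx power3_eq_cube power2_eq_square algebra_simps)
  ultimately show ?thesis by (simp add: algebra_simps)
qed

text \<open>The bound on the signals holds surely, so the integrals over the hidden state converge
  for every fixed observation.\<close>

locale gaussian_channel = prob_space M for M :: "'x measure" +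
  fixes I :: "'i set" and v :: "'i \<Rightarrow> 'x \<Rightarrow> real" and K :: real
  assumes finite_index: "finite I"
    and signal_measurable [measurable]: "e \<in> I \<Longrightarrow> v e \<in> borel_measurable M"
    and signal_bounded: "e \<in> I \<Longrightarrow> x \<in> space M \<Longrightarrow> \<bar>v e x\<bar> \<le> K"
begin

lemma weight_measurable_pair [measurable]:
  "(\<lambda>p. channel_weight I v (fst p) (snd p)) \<in> borel_measurable (M \<Otimes>\<^sub>M gauss I)"
  unfolding channel_weight_def by measurable

lemma weight_measurable_pair' [measurable]:
  "(\<lambda>p. channel_weight I v (snd p) (fst p)) \<in> borel_measurable (gauss I \<Otimes>\<^sub>M M)"
  unfolding channel_weight_def by measurable

lemma weight_measurable1 [measurable]: "(\<lambda>x. channel_weight I v x Y) \<in> borel_measurable M"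
  unfolding channel_weight_def by measurable

lemma weight_measurable2 [measurable]: "channel_weight I v x \<in> borel_measurable (gauss I)"
  unfolding channel_weight_def by measurable

lemma weight_bounded:
  assumes "x \<in> space M"
  shows "channel_weight I v x Y \<le> exp (\<Sum>e\<in>I. K * \<bar>Y e\<bar>)"
proof -
  have "v e x * Y e - (v e x)\<^sup>2 / 2 \<le> K * \<bar>Y e\<bar>" if "e \<in> I" for e
  proof -
    have "v e x * Y e \<le> \<bar>v e x\<bar> * \<bar>Y e\<bar>" by (metis abs_ge_self abs_mult)
    also have "\<dots> \<le> K * \<bar>Y e\<bar>" using signal_bounded[OF that assms] by (rule mult_right_mono) simp
    finally show ?thesis using zero_le_power2[of "v e x"] by linarith
  qed
  then show ?thesis unfolding channel_weight_def by (simp add: sum_mono)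
qed

lemma weight_power_integrable: "integrable M (\<lambda>x. (channel_weight I v x Y - c) ^ k)"
proof (rule integrable_const_bound)
  show "AE x in M. norm ((channel_weight I v x Y - c) ^ k) \<le> (exp (\<Sum>e\<in>I. K * \<bar>Y e\<bar>) + \<bar>c\<bar>) ^ k"
  proof (rule AE_I2)
    fix x assume "x \<in> space M"
    then have "\<bar>channel_weight I v x Y - c\<bar> \<le> exp (\<Sum>e\<in>I. K * \<bar>Y e\<bar>) + \<bar>c\<bar>"
      using weight_bounded[of x Y] channel_weight_pos[of I v x Y] by linarith
    then show "norm ((channel_weight I v x Y - c) ^ k) \<le> (exp (\<Sum>e\<in>I. K * \<bar>Y e\<bar>) + \<bar>c\<bar>) ^ k"
      by (simp add: power_abs power_mono)
  qed
qed measurable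

lemma weight_integrable: "integrable M (\<lambda>x. channel_weight I v x Y)"
  using weight_power_integrable[of Y 0 1] by simp

lemma ratio_measurable [measurable]: "channel_ratio M I v \<in> borel_measurable (gauss I)"
  unfolding channel_ratio_def
  by (rule borel_measurable_lebesgue_integral) (simp add: split_beta')

lemma ratio_pos: "0 < channel_ratio M I v Y"
  unfolding channel_ratio_def
  by (rule integral_less_AE_space[of "\<lambda>_. 0", simplified])
     (auto simp: weight_integrable channel_weight_pos emeasure_space_1)

lemma ennreal_ratio: "ennreal (channel_ratio M I v Y) = (\<integral>\<^sup>+x. ennreal (channel_weight I v x Y) \<partial>M)"
  unfolding channel_ratio_def
  by (rule nn_integral_eq_integral[symmetric]) (auto simp: weight_integrable channel_weight_pos less_imp_le)

lemma pair_gauss: "pair_sigma_finite M (gauss I)"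
  using prob_space_gauss[of I] prob_space_imp_sigma_finite
  by (auto intro!: pair_sigma_finite.intro prob_space_imp_sigma_finite prob_space_axioms)

lemma nn_integral_ratio: "(\<integral>\<^sup>+Y. ennreal (channel_ratio M I v Y) \<partial>gauss I) = 1"
proof -
  interpret MG: pair_sigma_finite M "gauss I" by (rule pair_gauss)
  have "(\<integral>\<^sup>+Y. ennreal (channel_ratio M I v Y) \<partial>gauss I)
      = (\<integral>\<^sup>+Y. (\<integral>\<^sup>+x. ennreal (channel_weight I v x Y) \<partial>M) \<partial>gauss I)"
    by (simp add: ennreal_ratio)
  also have "\<dots> = (\<integral>\<^sup>+x. (\<integral>\<^sup>+Y. ennreal (channel_weight I v x Y) \<partial>gauss I) \<partial>M)"
    by (rule MG.Fubini') (simp add: split_beta')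
  also have "\<dots> = (\<integral>\<^sup>+x. 1 \<partial>M)"
  proof (intro nn_integral_cong)
    fix x
    have "(\<integral>\<^sup>+Y. ennreal (channel_weight I v x Y) \<partial>gauss I) = ennreal (exp 0)"
      using has_bochner_integral_integral_eq[OF channel_weight_power_integral[OF finite_index, of v x 1]]
        channel_weight_power_integral[OF finite_index, of v x 1]
      by (subst nn_integral_eq_integral)
         (auto simp: channel_weight_pos less_imp_le has_bochner_integral_iff)
    then show "(\<integral>\<^sup>+Y. ennreal (channel_weight I v x Y) \<partial>gauss I) = 1" by simp
  qed
  finally show ?thesis by (simp add: emeasure_space_1)
qed

text \<open>The square is an integral over two independent replicas \<open>x\<close> and
  \<open>x'\<close>. In the Gaussian integral of the two weights the diagonal terms cancel and only
  the cross term survives.\<close>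

lemma nn_integral_ratio_square:
  "(\<integral>\<^sup>+Y. ennreal ((channel_ratio M I v Y)\<^sup>2) \<partial>gauss I)
     = (\<integral>\<^sup>+x. (\<integral>\<^sup>+x'. ennreal (exp (channel_kernel I v x x')) \<partial>M) \<partial>M)"
proof -
  interpret MG: pair_sigma_finite M "gauss I" by (rule pair_gauss)
  let ?w = "\<lambda>x Y. ennreal (channel_weight I v x Y)"
  have [measurable]: "channel_weight I v x \<in> borel_measurable (gauss I)" for x
    by measurable
  have meas [measurable]: "(\<lambda>p. \<integral>\<^sup>+x'. ?w (fst p) (snd p) * ?w x' (snd p) \<partial>M) \<in> borel_measurable (M \<Otimes>\<^sub>M gauss I)"
    unfolding channel_weight_def by measurable
  have "(\<integral>\<^sup>+Y. ennreal ((channel_ratio M I v Y)\<^sup>2) \<partial>gauss I)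
      = (\<integral>\<^sup>+Y. (\<integral>\<^sup>+x. (\<integral>\<^sup>+x'. ?w x Y * ?w x' Y \<partial>M) \<partial>M) \<partial>gauss I)"
    by (intro nn_integral_cong)
       (simp add: power2_eq_square ennreal_mult ratio_pos less_imp_le ennreal_ratio nn_integral_cmult nn_integral_multc)
  also have "\<dots> = (\<integral>\<^sup>+x. (\<integral>\<^sup>+Y. (\<integral>\<^sup>+x'. ?w x Y * ?w x' Y \<partial>M) \<partial>gauss I) \<partial>M)"
    by (rule MG.Fubini') (simp add: split_beta')
  also have "\<dots> = (\<integral>\<^sup>+x. (\<integral>\<^sup>+x'. (\<integral>\<^sup>+Y. ?w x Y * ?w x' Y \<partial>gauss I) \<partial>M) \<partial>M)"
    by (intro nn_integral_cong MG.Fubini') (simp add: split_beta' channel_weight_def)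
  also have "\<dots> = (\<integral>\<^sup>+x. (\<integral>\<^sup>+x'. ennreal (exp (channel_kernel I v x x')) \<partial>M) \<partial>M)"
  proof (intro nn_integral_cong)
    fix x x'
    let ?c = "exp (- (channel_kernel I v x x + channel_kernel I v x' x') / 2)"
    have "(\<integral>\<^sup>+Y. ?w x Y * ?w x' Y \<partial>gauss I)
        = (\<integral>\<^sup>+Y. ennreal ?c * ennreal (exp (\<Sum>e\<in>I. (v e x + v e x') * Y e)) \<partial>gauss I)"
      unfolding channel_weight_def channel_kernel_def
      by (intro nn_integral_cong)
         (simp add: ennreal_mult'[symmetric] exp_add[symmetric] sum_subtractf sum.distrib
            sum_divide_distrib[symmetric] algebra_simps power2_eq_square add_divide_distrib diff_divide_distrib)
    also have "\<dots> = ennreal ?c * ennreal (exp (\<Sum>e\<in>I. (v e x + v e x')\<^sup>2 / 2))"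
      by (subst nn_integral_cmult) (auto simp: nn_integral_gauss_exp[OF finite_index])
    also have "\<dots> = ennreal (exp (channel_kernel I v x x'))"
      unfolding channel_kernel_def
      by (simp add: ennreal_mult'[symmetric] exp_add[symmetric] sum.distrib algebra_simps
            sum_divide_distrib[symmetric] power2_eq_square add_divide_distrib diff_divide_distrib)
    finally show "(\<integral>\<^sup>+Y. ?w x Y * ?w x' Y \<partial>gauss I) = ennreal (exp (channel_kernel I v x x'))" .
  qed
  finally show ?thesis .
qed

lemma ratio_minus_one_fourth_power:
  "(channel_ratio M I v Y - 1) ^ 4 \<le> (\<integral>x. (channel_weight I v x Y - 1) ^ 4 \<partial>M)"
proof -
  have "(\<integral>x. channel_weight I v x Y - 1 \<partial>M) ^ 4 \<le> (\<integral>x. (channel_weight I v x Y - 1) ^ 4 \<partial>M)"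
    using weight_power_integrable[of Y 1 1]
    by (intro jensens_inequality[where I = UNIV and q = "\<lambda>t. t ^ 4"])
       (auto simp: weight_integrable weight_power_integrable convex_power_even)
  then show ?thesis
    by (simp add: channel_ratio_def weight_integrable prob_space)
qed

text \<open>Jensen's inequality moves the fourth power inside the average over the hidden state;
  Fubini then leaves the moment for a single state, which is of order
  \<open>h\<^sup>2\<close>.\<close>

lemma ratio_fourth_moment:
  assumes h: "\<And>x. x \<in> space M \<Longrightarrow> channel_kernel I v x x \<le> h" and h6: "h \<le> 1 / 6"
  shows "integrable (gauss I) (\<lambda>Y. (channel_ratio M I v Y - 1) ^ 4)"
    and "(\<integral>Y. (channel_ratio M I v Y - 1) ^ 4 \<partial>gauss I) \<le> 42 * h\<^sup>2"
proof -
  interpret MG: pair_sigma_finite M "gauss I" by (rule pair_gauss)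
  let ?w = "\<lambda>x Y. ennreal ((channel_weight I v x Y - 1) ^ 4)"
  have "(\<integral>\<^sup>+Y. ennreal ((channel_ratio M I v Y - 1) ^ 4) \<partial>gauss I)
      \<le> (\<integral>\<^sup>+Y. ennreal (\<integral>x. (channel_weight I v x Y - 1) ^ 4 \<partial>M) \<partial>gauss I)"
    by (intro nn_integral_mono ennreal_leI ratio_minus_one_fourth_power)
  also have "\<dots> = (\<integral>\<^sup>+Y. (\<integral>\<^sup>+x. ?w x Y \<partial>M) \<partial>gauss I)"
    by (intro nn_integral_cong nn_integral_eq_integral[symmetric] weight_power_integrable) auto
  also have "\<dots> = (\<integral>\<^sup>+x. (\<integral>\<^sup>+Y. ?w x Y \<partial>gauss I) \<partial>M)"
    by (rule MG.Fubini') (simp add: split_beta')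
  also have "\<dots> \<le> (\<integral>\<^sup>+x. ennreal (42 * h\<^sup>2) \<partial>M)"
  proof (intro nn_integral_mono)
    fix x assume x: "x \<in> space M"
    let ?k = "channel_kernel I v x x"
    have k: "0 \<le> ?k" "?k \<le> h"
      using h[OF x] by (auto simp: channel_kernel_def intro!: sum_nonneg)
    have "(\<integral>\<^sup>+Y. ?w x Y \<partial>gauss I) = ennreal (exp (6 * ?k) - 4 * exp (3 * ?k) + 6 * exp ?k - 3)"
      using channel_weight_fourth_moment[OF finite_index, of v x]
      by (subst nn_integral_eq_integral) (auto simp: has_bochner_integral_iff)
    also have "\<dots> \<le> ennreal (42 * ?k\<^sup>2)"
      using k h6 by (intro ennreal_leI exp_fourth_difference) auto
    also have "\<dots> \<le> ennreal (42 * h\<^sup>2)"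
      using k by (intro ennreal_leI mult_left_mono power_mono) auto
    finally show "(\<integral>\<^sup>+Y. ?w x Y \<partial>gauss I) \<le> ennreal (42 * h\<^sup>2)" .
  qed
  also have "\<dots> = ennreal (42 * h\<^sup>2)" by (simp add: emeasure_space_1)
  finally have le: "(\<integral>\<^sup>+Y. ennreal ((channel_ratio M I v Y - 1) ^ 4) \<partial>gauss I) \<le> ennreal (42 * h\<^sup>2)" .
  show int: "integrable (gauss I) (\<lambda>Y. (channel_ratio M I v Y - 1) ^ 4)"
    using le by (intro integrableI_nonneg) (auto simp: order_le_less_trans)
  show "(\<integral>Y. (channel_ratio M I v Y - 1) ^ 4 \<partial>gauss I) \<le> 42 * h\<^sup>2"
    using le by (subst (asm) nn_integral_eq_integral[OF int]) (auto simp: ennreal_le_iff)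
qed

text \<open>The ratio has mean one, so the linear term of the expansion integrates to zero and the
  second moment decides up to an error of order \<open>h * sqrt h\<close>.\<close>

lemma ratio_powr_moment:
  assumes u: "0 < u" "u < 1"
    and h: "\<And>x. x \<in> space M \<Longrightarrow> channel_kernel I v x x \<le> h" and h0: "0 < h" and h6: "h \<le> 1 / 6"
  shows "integrable (gauss I) (\<lambda>Y. channel_ratio M I v Y powr u)"
    and "integrable (gauss I) (\<lambda>Y. (channel_ratio M I v Y)\<^sup>2)"
    and "\<bar>(\<integral>Y. channel_ratio M I v Y powr u \<partial>gauss I)
           - (1 - u * (1 - u) / 2 * ((\<integral>Y. (channel_ratio M I v Y)\<^sup>2 \<partial>gauss I) - 1))\<bar>
         \<le> 528 * (h * sqrt h)"
proof -
  interpret G: prob_space "gauss I" by (rule prob_space_gauss)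
  define R where "R = channel_ratio M I v"
  have [measurable]: "R \<in> borel_measurable (gauss I)" unfolding R_def by measurable
  have Rpos: "0 < R Y" for Y unfolding R_def by (rule ratio_pos)
  have i4: "integrable (gauss I) (\<lambda>Y. (R Y - 1) ^ 4)" and m4: "(\<integral>Y. (R Y - 1) ^ 4 \<partial>gauss I) \<le> 42 * h\<^sup>2"
    using ratio_fourth_moment[OF h h6] unfolding R_def by auto
  have i1: "integrable (gauss I) R" and m1: "(\<integral>Y. R Y \<partial>gauss I) = 1"
  proof -
    have "has_bochner_integral (gauss I) R 1"
      using nn_integral_ratio Rpos
      by (intro has_bochner_integral_nn_integral) (auto simp: R_def less_imp_le)
    then show "integrable (gauss I) R" "(\<integral>Y. R Y \<partial>gauss I) = 1"
      by (auto simp: has_bochner_integral_iff)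
  qed
  have i2': "integrable (gauss I) (\<lambda>Y. (R Y - 1)\<^sup>2)"
  proof (rule Bochner_Integration.integrable_bound[of _ "\<lambda>Y. 1 + (R Y - 1) ^ 4"])
    show "AE Y in gauss I. norm ((R Y - 1)\<^sup>2) \<le> norm (1 + (R Y - 1) ^ 4)"
    proof (rule AE_I2)
      fix Y
      \<comment> \<open>A sum of squares shows that the fourth moment controls the second.\<close>
      have "0 \<le> ((R Y - 1)\<^sup>2 - 1)\<^sup>2 + (R Y - 1) ^ 4 + 1" by simp
      also have "\<dots> = 2 * (1 + (R Y - 1) ^ 4 - (R Y - 1)\<^sup>2)"
        by (simp add: power2_eq_square power4_eq_xxxx algebra_simps)
      finally show "norm ((R Y - 1)\<^sup>2) \<le> norm (1 + (R Y - 1) ^ 4)" by simp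
    qed
  qed (use i4 in auto)
  have "integrable (gauss I) (\<lambda>Y. (R Y - 1)\<^sup>2 + 2 * R Y - 1)"
    using i2' i1 by auto
  then have i2: "integrable (gauss I) (\<lambda>Y. (R Y)\<^sup>2)"
    by (rule Bochner_Integration.integrable_cong[THEN iffD1, rotated -1])
       (auto simp: power2_eq_square algebra_simps)
  have m2': "(\<integral>Y. (R Y - 1)\<^sup>2 \<partial>gauss I) = (\<integral>Y. (R Y)\<^sup>2 \<partial>gauss I) - 1"
    using i1 i2 m1 by (simp add: power2_diff G.prob_space)
  have "ennreal (\<integral>Y. (R Y)\<^sup>2 \<partial>gauss I) = (\<integral>\<^sup>+x. (\<integral>\<^sup>+x'. ennreal (exp (channel_kernel I v x x')) \<partial>M) \<partial>M)"
    using nn_integral_ratio_square nn_integral_eq_integral[OF i2] by (simp add: R_def)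
  also have "\<dots> \<le> (\<integral>\<^sup>+x. (\<integral>\<^sup>+x'. ennreal (exp h) \<partial>M) \<partial>M)"
  proof (intro nn_integral_mono ennreal_leI)
    fix x x' assume x: "x \<in> space M" "x' \<in> space M"
    have "v e x * v e x' \<le> (v e x * v e x + v e x' * v e x') / 2" for e
      using zero_le_power2[of "v e x - v e x'"] by (simp add: power2_eq_square algebra_simps)
    then have "channel_kernel I v x x' \<le> (\<Sum>e\<in>I. (v e x * v e x + v e x' * v e x') / 2)"
      unfolding channel_kernel_def by (rule sum_mono)
    also have "\<dots> = (channel_kernel I v x x + channel_kernel I v x' x') / 2"
      by (simp add: channel_kernel_def sum.distrib sum_divide_distrib[symmetric])
    also have "\<dots> \<le> h" using h[OF x(1)] h[OF x(2)] by simp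
    finally show "exp (channel_kernel I v x x') \<le> exp h" by simp
  qed
  also have "\<dots> = ennreal (exp h)" by (simp add: emeasure_space_1)
  finally have "(\<integral>Y. (R Y)\<^sup>2 \<partial>gauss I) \<le> exp h" by (simp add: ennreal_le_iff)
  moreover have "exp h \<le> 1 + h + h\<^sup>2" using h0 h6 by (intro exp_bound) auto
  moreover have "h\<^sup>2 \<le> h" using h0 h6 by (simp add: power2_eq_square mult_le_one)
  ultimately have m2: "(\<integral>Y. (R Y - 1)\<^sup>2 \<partial>gauss I) \<le> 2 * h" unfolding m2' by linarith
  have iu: "integrable (gauss I) (\<lambda>Y. R Y powr u)"
  proof (rule Bochner_Integration.integrable_bound[of _ "\<lambda>Y. 1 + R Y"])
    show "AE Y in gauss I. norm (R Y powr u) \<le> norm (1 + R Y)"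
    proof (rule AE_I2)
      fix Y
      have "R Y powr u \<le> (1 + R Y) powr u" using Rpos[of Y] u by (intro powr_mono2) auto
      also have "\<dots> \<le> (1 + R Y) powr 1" using Rpos[of Y] u by (intro powr_mono) auto
      finally show "norm (R Y powr u) \<le> norm (1 + R Y)" using Rpos[of Y] by simp
    qed
  qed (use i1 in auto)
  let ?q = "\<lambda>Y. 1 + u * (R Y - 1) - u * (1 - u) / 2 * (R Y - 1)\<^sup>2"
  \<comment> \<open>The parameter \<open>sqrt h\<close> balances the error:
    \<open>(R Y - 1)\<^sup>2\<close> has mean at most \<open>2 * h\<close> and
    \<open>(R Y - 1) ^ 4\<close> at most \<open>42 * h\<^sup>2\<close>, so both terms have order
    \<open>h * sqrt h\<close>, with total constant 12 * (2 + 42) = 528.\<close>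
  let ?b = "\<lambda>Y. 12 * (sqrt h * (R Y - 1)\<^sup>2 + (R Y - 1) ^ 4 / sqrt h)"
  have iq: "integrable (gauss I) ?q" and ib: "integrable (gauss I) ?b" using i1 i2' i4 by auto
  have mq: "(\<integral>Y. ?q Y \<partial>gauss I) = 1 - u * (1 - u) / 2 * ((\<integral>Y. (R Y)\<^sup>2 \<partial>gauss I) - 1)"
    using i1 i2' m1 by (simp add: m2'[symmetric] G.prob_space)
  have "\<bar>(\<integral>Y. R Y powr u \<partial>gauss I) - (\<integral>Y. ?q Y \<partial>gauss I)\<bar> = \<bar>\<integral>Y. R Y powr u - ?q Y \<partial>gauss I\<bar>"
    using iu iq by (subst Bochner_Integration.integral_diff) auto
  also have "\<dots> \<le> (\<integral>Y. \<bar>R Y powr u - ?q Y\<bar> \<partial>gauss I)"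
    by (rule integral_abs_bound)
  also have "\<dots> \<le> (\<integral>Y. ?b Y \<partial>gauss I)"
  proof (rule integral_mono)
    show "\<bar>R Y powr u - ?q Y\<bar> \<le> ?b Y" for Y
      using one_plus_powr_second_order'[OF u, of "R Y - 1" "sqrt h"] Rpos[of Y] h0 by simp
  qed (use iu iq ib in auto)
  also have "\<dots> = 12 * (sqrt h * (\<integral>Y. (R Y - 1)\<^sup>2 \<partial>gauss I) + (\<integral>Y. (R Y - 1) ^ 4 \<partial>gauss I) / sqrt h)"
    using i2' i4 by simp
  also have "\<dots> \<le> 12 * (sqrt h * (2 * h) + 42 * h\<^sup>2 / sqrt h)"
    using m2 m4 h0 by (intro mult_left_mono add_mono divide_right_mono) auto
  also have "\<dots> = 528 * (h * sqrt h)"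
  proof -
    have "h\<^sup>2 / sqrt h = h * sqrt h"
      using h0 by (simp add: power2_eq_square field_simps)
    moreover have "42 * h\<^sup>2 / sqrt h = 42 * (h\<^sup>2 / sqrt h)" by simp
    ultimately show ?thesis by (simp only: mult_ac) simp
  qed
  finally show "\<bar>(\<integral>Y. channel_ratio M I v Y powr u \<partial>gauss I)
           - (1 - u * (1 - u) / 2 * ((\<integral>Y. (channel_ratio M I v Y)\<^sup>2 \<partial>gauss I) - 1))\<bar>
         \<le> 528 * (h * sqrt h)"
    unfolding mq unfolding R_def .
  show "integrable (gauss I) (\<lambda>Y. channel_ratio M I v Y powr u)"
    and "integrable (gauss I) (\<lambda>Y. (channel_ratio M I v Y)\<^sup>2)"
    using iu i2 unfolding R_def .
qed

end

text \<open>Up to third order only the second moment of the ratio matters, and that is monotone in the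
  kernel: it is the double integral of \<open>exp\<close> of the kernel.\<close>

lemma channel_ratio_powr_step:
  assumes v: "gaussian_channel M I v K" and v': "gaussian_channel M I v' K'"
    and u: "0 < u" "u < 1"
    and h: "\<And>x. x \<in> space M \<Longrightarrow> channel_kernel I v x x \<le> h"
    and h': "\<And>x. x \<in> space M \<Longrightarrow> channel_kernel I v' x x \<le> h"
    and h0: "0 < h" and h6: "h \<le> 1 / 6"
    and le: "\<And>x x'. x \<in> space M \<Longrightarrow> x' \<in> space M \<Longrightarrow> channel_kernel I v' x x' \<le> channel_kernel I v x x'"
  shows "(\<integral>\<^sup>+Y. ennreal (channel_ratio M I v Y powr u) \<partial>gauss I)
     \<le> (\<integral>\<^sup>+Y. ennreal (channel_ratio M I v' Y powr u) \<partial>gauss I) + ennreal (1056 * (h * sqrt h))"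
proof -
  interpret V: gaussian_channel M I v K by (rule v)
  interpret V': gaussian_channel M I v' K' by (rule v')
  note m = V.ratio_powr_moment[OF u h h0 h6]
  note m' = V'.ratio_powr_moment[OF u h' h0 h6]
  have "ennreal (\<integral>Y. (channel_ratio M I v' Y)\<^sup>2 \<partial>gauss I) \<le> ennreal (\<integral>Y. (channel_ratio M I v Y)\<^sup>2 \<partial>gauss I)"
    using nn_integral_eq_integral[OF m(2)] nn_integral_eq_integral[OF m'(2)]
    by (simp flip: nn_integral_eq_integral[OF m(2)] nn_integral_eq_integral[OF m'(2)]
          add: V.nn_integral_ratio_square V'.nn_integral_ratio_square nn_integral_mono le)
  then have sq: "(\<integral>Y. (channel_ratio M I v' Y)\<^sup>2 \<partial>gauss I) \<le> (\<integral>Y. (channel_ratio M I v Y)\<^sup>2 \<partial>gauss I)"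
    by (subst (asm) ennreal_le_iff) auto
  \<comment> \<open>Concavity of the power enters here: the second moment occurs in the fractional
    moment with the coefficient \<open>- u * (1 - u) / 2\<close>, so the larger kernel has the
    smaller fractional moment. The errors of the two expansions add up to 2 * 528 = 1056.\<close>
  have "u * (1 - u) / 2 * ((\<integral>Y. (channel_ratio M I v' Y)\<^sup>2 \<partial>gauss I) - 1)
      \<le> u * (1 - u) / 2 * ((\<integral>Y. (channel_ratio M I v Y)\<^sup>2 \<partial>gauss I) - 1)"
    using u sq by (intro mult_left_mono) auto
  then have "(\<integral>Y. channel_ratio M I v Y powr u \<partial>gauss I)
      \<le> (\<integral>Y. channel_ratio M I v' Y powr u \<partial>gauss I) + 1056 * (h * sqrt h)"
    using m(3) m'(3) by linarith
  then show ?thesis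
    using h0 by (simp add: nn_integral_eq_integral[OF m(1)] nn_integral_eq_integral[OF m'(1)]
        ennreal_plus[symmetric] ennreal_leI del: ennreal_plus)
qed

section \<open>Posterior decomposition and comparison of kernels\<close>

definition (in gaussian_channel) posterior :: "('i \<Rightarrow> real) \<Rightarrow> 'x measure" where
  "posterior Y = density M (\<lambda>x. ennreal (channel_weight I v x Y / channel_ratio M I v Y))"

text \<open>Division by the ratio normalises the reweighted measure, and a density changes neither
  the space nor the measurable sets. Hence pointwise bounds on signals survive conditioning.\<close>

lemma (in gaussian_channel) posterior_channel:
  assumes "gaussian_channel M J v' K'"
  shows "gaussian_channel (posterior Y) J v' K'"
proof -
  interpret V: gaussian_channel M J v' K' by (rule assms)
  have "emeasure (posterior Y) (space (posterior Y))
      = (\<integral>\<^sup>+x. ennreal (channel_weight I v x Y / channel_ratio M I v Y) \<partial>M)"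
    unfolding posterior_def by (subst emeasure_density) (auto intro!: nn_integral_cong)
  also have "\<dots> = ennreal (\<integral>x. channel_weight I v x Y / channel_ratio M I v Y \<partial>M)"
    by (intro nn_integral_eq_integral)
       (auto simp: weight_integrable ratio_pos channel_weight_pos less_imp_le)
  also have "(\<integral>x. channel_weight I v x Y / channel_ratio M I v Y \<partial>M) = 1"
    using ratio_pos[of Y] by (simp add: channel_ratio_def)
  finally have p: "prob_space (posterior Y)" by (intro prob_spaceI) simp
  show ?thesis
  proof (intro gaussian_channel.intro gaussian_channel_axioms.intro p)
    show "v' e \<in> borel_measurable (posterior Y)" if "e \<in> J" for e
      using V.signal_measurable[OF that] by (simp add: posterior_def)
    show "\<bar>v' e x\<bar> \<le> K'" if "e \<in> J" "x \<in> space (posterior Y)" for e x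
      using V.signal_bounded that by (simp add: posterior_def)
  qed (rule V.finite_index)
qed

text \<open>Bayes' rule for two successive observations: the second channel has the posterior of the
  first as its prior.\<close>

lemma (in gaussian_channel) posterior_ratio:
  assumes "gaussian_channel M J v' K'"
  shows "(\<integral>x. channel_weight I v x Y * channel_weight J v' x Y' \<partial>M)
     = channel_ratio M I v Y * channel_ratio (posterior Y) J v' Y'"
proof -
  interpret V: gaussian_channel M J v' K' by (rule assms)
  have "channel_ratio (posterior Y) J v' Y'
      = (\<integral>x. (channel_weight I v x Y / channel_ratio M I v Y) * channel_weight J v' x Y' \<partial>M)"
    unfolding channel_ratio_def posterior_def
    by (subst integral_density) (auto simp: channel_ratio_def[symmetric] ratio_pos channel_weight_pos less_imp_le)
  also have "\<dots> = (\<integral>x. (channel_weight I v x Y * channel_weight J v' x Y') / channel_ratio M I v Y \<partial>M)"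
    by (intro Bochner_Integration.integral_cong) auto
  also have "\<dots> = (\<integral>x. channel_weight I v x Y * channel_weight J v' x Y' \<partial>M) / channel_ratio M I v Y"
    by simp
  finally show ?thesis using ratio_pos[of Y] by simp
qed

text \<open>The coefficients are signal-to-noise ratios. The square root makes the kernel linear in
  them, as interpolation requires.\<close>

abbreviation scaled_signal :: "('i \<Rightarrow> real) \<Rightarrow> ('i \<Rightarrow> 'x \<Rightarrow> real) \<Rightarrow> 'i \<Rightarrow> 'x \<Rightarrow> real" where
  "scaled_signal a s \<equiv> (\<lambda>e x. sqrt (a e) * s e x)"

text \<open>Valued in \<open>ennreal\<close>, so that Fubini and monotonicity apply without
  integrability conditions.\<close>

definition fractional_moment ::
    "real \<Rightarrow> 'x measure \<Rightarrow> 'i set \<Rightarrow> ('i \<Rightarrow> 'x \<Rightarrow> real) \<Rightarrow> ennreal" where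
  "fractional_moment u M I v = (\<integral>\<^sup>+Y. ennreal (channel_ratio M I v Y powr u) \<partial>gauss I)"

text \<open>For \<open>z > 0\<close> the power \<open>z powr u\<close> is at most
  \<open>1 + z\<close>, and the ratio has mean one.\<close>

lemma (in gaussian_channel) fractional_moment_le:
  assumes u: "0 < u" "u < 1"
  shows "fractional_moment u M I v \<le> 2"
proof -
  interpret G: prob_space "gauss I" by (rule prob_space_gauss)
  have "fractional_moment u M I v \<le> (\<integral>\<^sup>+Y. 1 + ennreal (channel_ratio M I v Y) \<partial>gauss I)"
    unfolding fractional_moment_def
  proof (intro nn_integral_mono)
    fix Y
    have "channel_ratio M I v Y powr u \<le> (1 + channel_ratio M I v Y) powr u"
      using ratio_pos[of Y] u by (intro powr_mono2) auto
    also have "\<dots> \<le> (1 + channel_ratio M I v Y) powr 1"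
      using ratio_pos[of Y] u by (intro powr_mono) auto
    finally have "ennreal (channel_ratio M I v Y powr u) \<le> ennreal (1 + channel_ratio M I v Y)"
      using ratio_pos[of Y] by (intro ennreal_leI) auto
    then show "ennreal (channel_ratio M I v Y powr u) \<le> 1 + ennreal (channel_ratio M I v Y)"
      using ratio_pos[of Y] by simp
  qed
  also have "\<dots> = 2"
    by (subst nn_integral_add) (auto simp: nn_integral_ratio G.emeasure_space_1)
  finally show ?thesis .
qed

lemma (in gaussian_channel) scaled_channel:
  assumes a: "\<And>e. e \<in> I \<Longrightarrow> 0 \<le> a e"
  shows "gaussian_channel M I (scaled_signal a v) (sqrt (\<Sum>e\<in>I. a e) * K)"
proof (intro gaussian_channel.intro gaussian_channel_axioms.intro prob_space_axioms finite_index)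
  fix e x assume e: "e \<in> I" and x: "x \<in> space M"
  have "a e \<le> (\<Sum>e\<in>I. a e)" using e a finite_index by (intro member_le_sum) auto
  then show "\<bar>sqrt (a e) * v e x\<bar> \<le> sqrt (\<Sum>e\<in>I. a e) * K"
    using signal_bounded[OF e x] a[OF e] by (simp add: abs_mult mult_mono)
qed measurable

lemma scaled_kernel:
  assumes "\<And>e. e \<in> I \<Longrightarrow> 0 \<le> a e"
  shows "channel_kernel I (scaled_signal a s) x x' = (\<Sum>e\<in>I. a e * s e x * s e x')"
  unfolding channel_kernel_def
proof (intro sum.cong refl)
  fix e assume e: "e \<in> I"
  have "sqrt (a e) * s e x * (sqrt (a e) * s e x') = (sqrt (a e) * sqrt (a e)) * s e x * s e x'"
    by (simp only: mult_ac)
  then show "sqrt (a e) * s e x * (sqrt (a e) * s e x') = a e * s e x * s e x'"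
    using assms[OF e] by simp
qed

text \<open>One observation with coefficients \<open>a + b\<close> is as informative as two
  independent ones with \<open>a\<close> and \<open>b\<close>, because the product of the two
  weights depends only on a weighted sum of the observations.\<close>

lemma (in gaussian_channel) fractional_moment_split:
  assumes a: "\<And>e. e \<in> I \<Longrightarrow> 0 \<le> a e" and b: "\<And>e. e \<in> I \<Longrightarrow> 0 \<le> b e"
  shows "fractional_moment u M I (scaled_signal (\<lambda>e. a e + b e) v)
    = (\<integral>\<^sup>+Y. (\<integral>\<^sup>+Y'. ennreal ((\<integral>x. channel_weight I (scaled_signal a v) x Y
                                 * channel_weight I (scaled_signal b v) x Y' \<partial>M) powr u) \<partial>gauss I) \<partial>gauss I)"
proof -
  \<comment> \<open>The ratio is regarded as a function of the sufficient statistic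
    \<open>sqrt (a e + b e) * Y e\<close>, whose law splits into two independent parts.\<close>
  define f where "f \<xi> = ennreal ((\<integral>x. exp (\<Sum>e\<in>I. v e x * \<xi> e - (a e + b e) * (v e x)\<^sup>2 / 2) \<partial>M) powr u)" for \<xi>
  have f [measurable]: "f \<in> borel_measurable (PiM I (\<lambda>_. borel))"
    unfolding f_def by measurable
  have f_split: "f (\<lambda>e\<in>I. sqrt (a e) * Y e + sqrt (b e) * Y' e)
      = ennreal ((\<integral>x. channel_weight I (scaled_signal a v) x Y
                                 * channel_weight I (scaled_signal b v) x Y' \<partial>M) powr u)" for Y Y'
  proof -
    have "exp (\<Sum>e\<in>I. v e x * (\<lambda>e\<in>I. sqrt (a e) * Y e + sqrt (b e) * Y' e) e - (a e + b e) * (v e x)\<^sup>2 / 2)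
        = channel_weight I (scaled_signal a v) x Y * channel_weight I (scaled_signal b v) x Y'" for x
      unfolding channel_weight_def exp_add[symmetric] sum.distrib[symmetric] using a b
      by (intro arg_cong[where f = exp] sum.cong)
         (auto simp: power_mult_distrib algebra_simps add_divide_distrib)
    then show ?thesis unfolding f_def by simp
  qed
  have "fractional_moment u M I (scaled_signal (\<lambda>e. a e + b e) v)
      = (\<integral>\<^sup>+Y. f (\<lambda>e\<in>I. sqrt (a e + b e) * Y e) \<partial>gauss I)"
    unfolding fractional_moment_def f_def channel_ratio_def channel_weight_def
    using a b by (simp add: mult_ac power_mult_distrib cong: sum.cong)
  also have "\<dots> = (\<integral>\<^sup>+Y. (\<integral>\<^sup>+Y'. f (\<lambda>e\<in>I. sqrt (a e) * Y e + sqrt (b e) * Y' e) \<partial>gauss I) \<partial>gauss I)"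
    by (rule nn_integral_gauss_add_scaled[OF finite_index a b f])
  finally show ?thesis unfolding f_split .
qed

text \<open>The observation with coefficients \<open>a\<close> is frozen, and the small increments
  \<open>b\<close> and \<open>b'\<close> are compared under its posterior. The kernel inequality is
  pointwise, so it holds under every posterior. Averaging multiplies the error by a fractional
  moment of at most 2, whence 2112.\<close>

lemma (in gaussian_channel) fractional_moment_step:
  assumes u: "0 < u" "u < 1"
    and a: "\<And>e. e \<in> I \<Longrightarrow> 0 \<le> a e"
    and b: "\<And>e. e \<in> I \<Longrightarrow> 0 \<le> b e" and b': "\<And>e. e \<in> I \<Longrightarrow> 0 \<le> b' e"
    and h: "\<And>x. x \<in> space M \<Longrightarrow> channel_kernel I (scaled_signal b v) x x \<le> h"
    and h': "\<And>x. x \<in> space M \<Longrightarrow> channel_kernel I (scaled_signal b' v) x x \<le> h"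
    and h0: "0 < h" and h6: "h \<le> 1 / 6"
    and le: "\<And>x x'. x \<in> space M \<Longrightarrow> x' \<in> space M \<Longrightarrow>
        channel_kernel I (scaled_signal b' v) x x' \<le> channel_kernel I (scaled_signal b v) x x'"
  shows "fractional_moment u M I (scaled_signal (\<lambda>e. a e + b e) v)
    \<le> fractional_moment u M I (scaled_signal (\<lambda>e. a e + b' e) v) + ennreal (2112 * (h * sqrt h))"
proof -
  interpret G: prob_space "gauss I" by (rule prob_space_gauss)
  interpret A: gaussian_channel M I "scaled_signal a v" "sqrt (\<Sum>e\<in>I. a e) * K"
    by (rule scaled_channel[OF a])
  note chan = scaled_channel[OF b] scaled_channel[OF b']
  let ?Z = "channel_ratio M I (scaled_signal a v)"
  let ?w = "\<lambda>b Y Y'. (\<integral>x. channel_weight I (scaled_signal a v) x Y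
                                 * channel_weight I (scaled_signal b v) x Y' \<partial>M) powr u"
  have w: "(\<integral>\<^sup>+Y'. ennreal (?w c Y Y') \<partial>gauss I)
      = ennreal (?Z Y powr u) * fractional_moment u (A.posterior Y) I (scaled_signal c v)"
    if c: "\<And>e. e \<in> I \<Longrightarrow> 0 \<le> c e" for c Y
  proof -
    interpret C: gaussian_channel "A.posterior Y" I "scaled_signal c v" "sqrt (\<Sum>e\<in>I. c e) * K"
      by (rule A.posterior_channel[OF scaled_channel[OF c]])
    have eq: "(\<integral>x. channel_weight I (scaled_signal a v) x Y * channel_weight I (scaled_signal c v) x Y' \<partial>M)
        = ?Z Y * channel_ratio (A.posterior Y) I (scaled_signal c v) Y'" for Y'
      by (rule A.posterior_ratio[OF scaled_channel[OF c]])
    show ?thesis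
      unfolding eq fractional_moment_def
      using A.ratio_pos[of Y] C.ratio_pos
      by (simp add: powr_mult less_imp_le ennreal_mult nn_integral_cmult)
  qed
  have meas [measurable]: "(\<lambda>Y. \<integral>\<^sup>+Y'. ennreal (?w b' Y Y') \<partial>gauss I) \<in> borel_measurable (gauss I)"
    unfolding channel_weight_def by measurable
  have "fractional_moment u M I (scaled_signal (\<lambda>e. a e + b e) v)
      = (\<integral>\<^sup>+Y. ennreal (?Z Y powr u) * fractional_moment u (A.posterior Y) I (scaled_signal b v) \<partial>gauss I)"
    by (simp add: fractional_moment_split[OF a b] w[OF b])
  also have "\<dots> \<le> (\<integral>\<^sup>+Y. ennreal (?Z Y powr u) *
      (fractional_moment u (A.posterior Y) I (scaled_signal b' v) + ennreal (1056 * (h * sqrt h))) \<partial>gauss I)"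
  proof (intro nn_integral_mono mult_left_mono)
    fix Y
    have sp: "space (A.posterior Y) = space M" by (simp add: A.posterior_def)
    show "fractional_moment u (A.posterior Y) I (scaled_signal b v)
        \<le> fractional_moment u (A.posterior Y) I (scaled_signal b' v) + ennreal (1056 * (h * sqrt h))"
      unfolding fractional_moment_def
      by (rule channel_ratio_powr_step[OF A.posterior_channel[OF chan(1)] A.posterior_channel[OF chan(2)] u])
         (use h h' h0 h6 le in \<open>auto simp: sp\<close>)
  qed simp
  also have "\<dots> = (\<integral>\<^sup>+Y. (\<integral>\<^sup>+Y'. ennreal (?w b' Y Y') \<partial>gauss I)
      + ennreal (?Z Y powr u) * ennreal (1056 * (h * sqrt h)) \<partial>gauss I)"
    by (simp add: w[OF b'] distrib_left)
  also have "\<dots> = fractional_moment u M I (scaled_signal (\<lambda>e. a e + b' e) v)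
      + fractional_moment u M I (scaled_signal a v) * ennreal (1056 * (h * sqrt h))"
    by (simp only: fractional_moment_split[OF a b'], unfold fractional_moment_def, subst nn_integral_add)
       (auto simp: nn_integral_multc)
  also have "fractional_moment u M I (scaled_signal a v) * ennreal (1056 * (h * sqrt h))
      \<le> 2 * ennreal (1056 * (h * sqrt h))"
    by (intro mult_right_mono A.fractional_moment_le u) simp
  also have "2 * ennreal (1056 * (h * sqrt h)) = ennreal (2112 * (h * sqrt h))"
    by (subst ennreal_numeral[symmetric], subst ennreal_mult'[symmetric]) (use h0 in auto)
  finally show ?thesis by (simp add: add_left_mono)
qed

text \<open>Kahane's comparison. The coefficients move from \<open>b'\<close> to \<open>b\<close> in \<open>n\<close> equal steps; by the posterior
  decomposition each step costs \<open>O(n\<^bsup>-3/2\<^esup>)\<close>, so the total error vanishes.\<close>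

theorem (in gaussian_channel) fractional_moment_antimono:
  assumes u: "0 < u" "u < 1"
    and b: "\<And>e. e \<in> I \<Longrightarrow> 0 \<le> b e" and b': "\<And>e. e \<in> I \<Longrightarrow> 0 \<le> b' e"
    and le: "\<And>x x'. x \<in> space M \<Longrightarrow> x' \<in> space M \<Longrightarrow>
        (\<Sum>e\<in>I. b' e * v e x * v e x') \<le> (\<Sum>e\<in>I. b e * v e x * v e x')"
  shows "fractional_moment u M I (scaled_signal b v) \<le> fractional_moment u M I (scaled_signal b' v)"
proof -
  \<comment> \<open>\<open>S\<close> bounds the diagonal of the kernel for all coefficients between
    0 and \<open>b + b'\<close>. The summand 1 makes it positive, since the one-step comparison asks
    for \<open>0 < h\<close>.\<close>
  define S where "S = 1 + (\<Sum>e\<in>I. b e + b' e) * K\<^sup>2"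
  have S: "0 < S" unfolding S_def using b b' by (intro add_pos_nonneg mult_nonneg_nonneg sum_nonneg) auto
  have diag: "(\<Sum>e\<in>I. c e * v e x * v e x) \<le> S"
    if x: "x \<in> space M" and c: "\<And>e. e \<in> I \<Longrightarrow> 0 \<le> c e \<and> c e \<le> b e + b' e" for c x
  proof -
    have "(\<Sum>e\<in>I. c e * v e x * v e x) \<le> (\<Sum>e\<in>I. (b e + b' e) * K\<^sup>2)"
    proof (intro sum_mono)
      fix e assume e: "e \<in> I"
      have "\<bar>v e x\<bar>\<^sup>2 \<le> K\<^sup>2"
        using signal_bounded[OF e x] by (intro power_mono) auto
      then have "c e * (v e x)\<^sup>2 \<le> (b e + b' e) * K\<^sup>2"
        using c[OF e] by (intro mult_mono) auto
      then show "c e * v e x * v e x \<le> (b e + b' e) * K\<^sup>2"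
        by (simp add: power2_eq_square mult.assoc)
    qed
    then show ?thesis by (simp add: S_def sum_distrib_right)
  qed
  let ?F = "\<lambda>c. fractional_moment u M I (scaled_signal c v)"
  have bound: "?F b \<le> ?F b' + ennreal (2112 * S * sqrt (S / real n))"
    if n: "0 < n" "S / real n \<le> 1 / 6" for n
  proof -
    \<comment> \<open>Linear interpolation from \<open>b'\<close> at \<open>k = 0\<close> to
      \<open>b\<close> at \<open>k = n\<close>.\<close>
    define c where "c k = (\<lambda>e. (real k * b e + real (n - k) * b' e) / real n)" for k
    let ?eps = "2112 * (S / real n * sqrt (S / real n))"
    have step: "?F (c (Suc k)) \<le> ?F (c k) + ennreal ?eps" if k: "k < n" for k
    proof -
      \<comment> \<open>The part common to \<open>c k\<close> and \<open>c (Suc k)\<close>: these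
        differ only in one last share, \<open>b' e / real n\<close> against
        \<open>b e / real n\<close>.\<close>
      let ?a = "\<lambda>e. (real k * b e + real (n - Suc k) * b' e) / real n"
      have "c (Suc k) = (\<lambda>e. ?a e + b e / real n)"
        using n by (auto simp: c_def field_simps)
      moreover have "c k = (\<lambda>e. ?a e + b' e / real n)"
        using n k by (auto simp: c_def field_simps of_nat_diff)
      moreover have "?F (\<lambda>e. ?a e + b e / real n) \<le> ?F (\<lambda>e. ?a e + b' e / real n) + ennreal ?eps"
      proof (rule fractional_moment_step[OF u])
        fix x assume x: "x \<in> space M"
        have "(\<Sum>e\<in>I. b e * v e x * v e x) \<le> S" "(\<Sum>e\<in>I. b' e * v e x * v e x) \<le> S"
          using b b' by (intro diag[OF x]; simp)+
        then have "(\<Sum>e\<in>I. b e * v e x * v e x) / real n \<le> S / real n"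
          "(\<Sum>e\<in>I. b' e * v e x * v e x) / real n \<le> S / real n"
          by (auto intro: divide_right_mono)
        then show "channel_kernel I (scaled_signal (\<lambda>e. b e / real n) v) x x \<le> S / real n"
          "channel_kernel I (scaled_signal (\<lambda>e. b' e / real n) v) x x \<le> S / real n"
          using b b' by (simp_all add: scaled_kernel sum_divide_distrib del: real_sqrt_divide)
      next
        fix x x' assume x: "x \<in> space M" "x' \<in> space M"
        have "(\<Sum>e\<in>I. b' e * v e x * v e x') / real n \<le> (\<Sum>e\<in>I. b e * v e x * v e x') / real n"
          using le[OF x] by (rule divide_right_mono) simp
        then show "channel_kernel I (scaled_signal (\<lambda>e. b' e / real n) v) x x'
            \<le> channel_kernel I (scaled_signal (\<lambda>e. b e / real n) v) x x'"
          using b b' by (simp add: scaled_kernel sum_divide_distrib del: real_sqrt_divide)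
      qed (use b b' n S in auto)
      ultimately show ?thesis by simp
    qed
    have "k \<le> n \<Longrightarrow> ?F (c k) \<le> ?F (c 0) + ennreal (real k * ?eps)" for k
    proof (induction k)
      case (Suc k)
      have "?F (c (Suc k)) \<le> ?F (c k) + ennreal ?eps" using Suc.prems by (intro step) simp
      also have "\<dots> \<le> ?F (c 0) + ennreal (real k * ?eps) + ennreal ?eps"
        using Suc by (intro add_right_mono) simp
      also have "\<dots> = ?F (c 0) + ennreal (real (Suc k) * ?eps)"
        using S by (simp add: add.assoc distrib_right add_divide_distrib flip: ennreal_plus)
      finally show ?case .
    qed simp
    then have "?F (c n) \<le> ?F (c 0) + ennreal (real n * ?eps)" by blast
    moreover have "c n = b" "c 0 = b'" using n by (auto simp: c_def)
    moreover have "real n * ?eps = 2112 * S * sqrt (S / real n)" using n by simp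
    ultimately show ?thesis by (simp only:)
  qed
  have lim: "(\<lambda>n. ?F b' + ennreal (2112 * S * sqrt (S / real n))) \<longlonglongrightarrow> ?F b' + ennreal (2112 * S * sqrt 0)"
    by (intro tendsto_add tendsto_const tendsto_ennrealI tendsto_mult tendsto_real_sqrt lim_const_over_n)
  have "\<forall>\<^sub>F n in sequentially. S / real n < 1 / 6"
    using lim_const_over_n[of S] by (rule order_tendstoD) simp
  then have "\<forall>\<^sub>F n in sequentially. ?F b \<le> ?F b' + ennreal (2112 * S * sqrt (S / real n))"
    using eventually_gt_at_top[of 0] by eventually_elim (auto intro!: bound)
  then have "?F b \<le> ?F b' + ennreal (2112 * S * sqrt 0)"
    by (intro tendsto_lowerbound[OF lim]) auto
  then show ?thesis by simp
qed

section \<open>Silent and constant signals\<close>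

lemma channel_ratio_zero_signals:
  assumes B: "finite B" and AB: "A \<subseteq> B" and zero: "\<And>e x. e \<in> B - A \<Longrightarrow> x \<in> space M \<Longrightarrow> v e x = 0"
  shows "channel_ratio M B v Y = channel_ratio M A v (restrict Y A)"
proof -
  have "channel_weight B v x Y = channel_weight A v x (restrict Y A)" if "x \<in> space M" for x
    unfolding channel_weight_def using B AB zero[OF _ that]
    by (intro arg_cong[where f = exp] sum.mono_neutral_cong_right) auto
  then show ?thesis unfolding channel_ratio_def by (intro Bochner_Integration.integral_cong) auto
qed

text \<open>Coordinates without signal are pure noise and integrate out. Channels with different
  active coordinates can therefore be compared on a common index set.\<close>

lemma fractional_moment_zero_signals:
  assumes A: "gaussian_channel M A v K" and B: "finite B" and AB: "A \<subseteq> B"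
    and zero: "\<And>e x. e \<in> B - A \<Longrightarrow> x \<in> space M \<Longrightarrow> v e x = 0"
  shows "fractional_moment u M B v = fractional_moment u M A v"
proof -
  interpret A: gaussian_channel M A v K by (rule A)
  interpret S: prob_space std_normal_distribution by (rule prob_space_std_normal)
  interpret G: product_prob_space "\<lambda>_::'b. std_normal_distribution" B by standard
  have [measurable]: "(\<lambda>f. restrict f A) \<in> measurable (gauss B) (gauss A)"
    by (rule measurable_restrict_subset[OF AB])
  have eq: "channel_ratio M B v Y = channel_ratio M A v (restrict Y A)" for Y
    by (rule channel_ratio_zero_signals[OF B AB zero])
  have "fractional_moment u M A v
      = (\<integral>\<^sup>+Y. ennreal (channel_ratio M A v Y powr u) \<partial>distr (gauss B) (gauss A) (\<lambda>f. restrict f A))"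
    unfolding fractional_moment_def using G.distr_restrict[OF AB B] by simp
  also have "\<dots> = (\<integral>\<^sup>+Y. ennreal (channel_ratio M A v (restrict Y A) powr u) \<partial>gauss B)"
    by (rule nn_integral_distr) measurable
  also have "\<dots> = fractional_moment u M B v"
    by (simp add: fractional_moment_def eq)
  finally show ?thesis by simp
qed

lemma nn_integral_std_normal_exp:
  "(\<integral>\<^sup>+y. ennreal (exp (t * y)) \<partial>std_normal_distribution) = ennreal (exp (t\<^sup>2 / 2))"
proof -
  interpret S: prob_space std_normal_distribution by (rule prob_space_std_normal)
  interpret G: product_sigma_finite "\<lambda>_::unit. std_normal_distribution" by standard
  have "(\<integral>\<^sup>+Y. ennreal (exp (t * Y ())) \<partial>gauss {()}) = (\<integral>\<^sup>+y. ennreal (exp (t * y)) \<partial>std_normal_distribution)"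
    using G.product_nn_integral_singleton[of "\<lambda>y. ennreal (exp (t * y))" "()"] by simp
  then show ?thesis using nn_integral_gauss_exp[of "{()}" "\<lambda>_. t"] by simp
qed

text \<open>A signal independent of the hidden state multiplies the ratio by
  \<open>exp (t * Y i - t\<^sup>2 / 2)\<close>, independent of the rest, and the \<open>u\<close>-th
  power of this factor has mean \<open>exp ((u\<^sup>2 - u) * t\<^sup>2 / 2)\<close>. This is the
  effect of adding the constant \<open>t\<^sup>2\<close> to a kernel.\<close>

lemma fractional_moment_constant_signal:
  assumes A: "gaussian_channel M A v K" and i: "i \<notin> A"
    and const: "\<And>x. x \<in> space M \<Longrightarrow> v i x = t"
  shows "fractional_moment u M (insert i A) v = ennreal (exp (- u * (1 - u) * t\<^sup>2 / 2)) * fractional_moment u M A v"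
proof -
  interpret A: gaussian_channel M A v K by (rule A)
  interpret S: prob_space std_normal_distribution by (rule prob_space_std_normal)
  interpret G: product_sigma_finite "\<lambda>_::'b. std_normal_distribution" by standard
  have ratio: "channel_ratio M (insert i A) v Y = exp (t * Y i - t\<^sup>2 / 2) * channel_ratio M A v Y" for Y
  proof -
    have "channel_weight (insert i A) v x Y = exp (t * Y i - t\<^sup>2 / 2) * channel_weight A v x Y"
      if "x \<in> space M" for x
      unfolding channel_weight_def using A.finite_index i const[OF that] by (simp add: exp_add)
    then have "channel_ratio M (insert i A) v Y = (\<integral>x. exp (t * Y i - t\<^sup>2 / 2) * channel_weight A v x Y \<partial>M)"
      unfolding channel_ratio_def by (intro Bochner_Integration.integral_cong) auto
    then show ?thesis by (simp add: channel_ratio_def)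
  qed
  have B: "gaussian_channel M (insert i A) v (max K \<bar>t\<bar>)"
  proof (intro gaussian_channel.intro gaussian_channel_axioms.intro A.prob_space_axioms)
    have "v i \<in> borel_measurable M"
      using const measurable_cong[of M "v i" "\<lambda>_. t" borel] by simp
    then show "v e \<in> borel_measurable M" if "e \<in> insert i A" for e using that by auto
    show "\<bar>v e x\<bar> \<le> max K \<bar>t\<bar>" if "e \<in> insert i A" "x \<in> space M" for e x
      using that const[OF that(2)] A.signal_bounded[OF _ that(2)] by (auto simp: le_max_iff_disj)
  qed (use A.finite_index in auto)
  interpret B: gaussian_channel M "insert i A" v "max K \<bar>t\<bar>" by (rule B)
  let ?c = "- u * (t\<^sup>2 / 2)"
  have "fractional_moment u M (insert i A) v
      = (\<integral>\<^sup>+Y. (\<integral>\<^sup>+y. ennreal (channel_ratio M (insert i A) v (Y(i := y)) powr u) \<partial>std_normal_distribution) \<partial>gauss A)"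
    unfolding fractional_moment_def
    by (rule G.product_nn_integral_insert[OF A.finite_index i]) measurable
  also have "\<dots> = (\<integral>\<^sup>+Y. (\<integral>\<^sup>+y. ennreal (channel_ratio M A v Y powr u) * (ennreal (exp ?c) * ennreal (exp ((u * t) * y))) \<partial>std_normal_distribution) \<partial>gauss A)"
  proof (intro nn_integral_cong)
    fix Y y
    have "channel_ratio M A v (Y(i := y)) = channel_ratio M A v Y"
      unfolding channel_ratio_def channel_weight_def using i
      by (intro Bochner_Integration.integral_cong arg_cong[where f = exp] sum.cong) auto
    then have "channel_ratio M (insert i A) v (Y(i := y)) powr u
        = channel_ratio M A v Y powr u * (exp ?c * exp ((u * t) * y))"
      unfolding ratio using A.ratio_pos[of Y]
      by (simp add: powr_mult exp_powr_real exp_add[symmetric] algebra_simps)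
    then show "ennreal (channel_ratio M (insert i A) v (Y(i := y)) powr u)
        = ennreal (channel_ratio M A v Y powr u) * (ennreal (exp ?c) * ennreal (exp ((u * t) * y)))"
      by (simp add: ennreal_mult)
  qed
  also have "\<dots> = (\<integral>\<^sup>+Y. ennreal (channel_ratio M A v Y powr u) * (ennreal (exp ?c) * ennreal (exp ((u * t)\<^sup>2 / 2))) \<partial>gauss A)"
    by (simp add: nn_integral_cmult nn_integral_std_normal_exp)
  also have "\<dots> = fractional_moment u M A v * (ennreal (exp ?c) * ennreal (exp ((u * t)\<^sup>2 / 2)))"
    unfolding fractional_moment_def by (rule nn_integral_multc) measurable
  also have "ennreal (exp ?c) * ennreal (exp ((u * t)\<^sup>2 / 2)) = ennreal (exp (- u * (1 - u) * t\<^sup>2 / 2))"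
    by (simp add: ennreal_mult'[symmetric] exp_add[symmetric] power_mult_distrib)
       (simp add: power2_eq_square algebra_simps diff_divide_distrib)
  finally show ?thesis by (simp add: mult.commute)
qed

section \<open>The matrix kernel against the scalar kernel\<close>

lemma sum_pairs_product:
  fixes p :: "nat \<Rightarrow> real"
  shows "2 * (\<Sum>e\<in>pairs N. p (fst e) * p (snd e)) = (\<Sum>i=1..N. p i)\<^sup>2 - (\<Sum>i=1..N. (p i)\<^sup>2)"
proof (induction N)
  case 0
  have "pairs 0 = {}" by (auto simp: pairs_def)
  then show ?case by simp
next
  case (Suc N)
  have *: "pairs (Suc N) = pairs N \<union> (\<lambda>i. (i, Suc N)) ` {1..N}"
    by (auto simp: pairs_def image_iff le_Suc_eq)
  have "pairs N \<inter> (\<lambda>i. (i, Suc N)) ` {1..N} = {}" by (auto simp: pairs_def)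
  then have "(\<Sum>e\<in>pairs (Suc N). p (fst e) * p (snd e))
      = (\<Sum>e\<in>pairs N. p (fst e) * p (snd e)) + (\<Sum>i=1..N. p i) * p (Suc N)"
    unfolding * by (subst sum.union_disjoint) (auto simp: sum.reindex inj_on_def sum_distrib_right)
  then show ?case using Suc by (simp add: power2_sum algebra_simps power2_eq_square)
qed

text \<open>The square of \<open>?S - q * real N\<close> is nonnegative; the inequality is scaled by
  \<open>lam / (2 * real N)\<close>. The pairs omit the diagonal, whose \<open>N\<close> terms are
  at most \<open>K ^ 4\<close> each, at a cost of \<open>lam * K ^ 4 / 2\<close>.\<close>

lemma pair_kernel_lower_bound:
  fixes p :: "nat \<Rightarrow> real"
  assumes lam: "0 \<le> lam" and N: "0 < N" and p: "\<And>i. i \<in> {1..N} \<Longrightarrow> \<bar>p i\<bar> \<le> K\<^sup>2"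
  shows "lam * q * (\<Sum>i=1..N. p i)
     \<le> lam / real N * (\<Sum>e\<in>pairs N. p (fst e) * p (snd e)) + (lam * real N * q\<^sup>2 / 2 + lam * K ^ 4 / 2)"
proof -
  let ?S = "\<Sum>i=1..N. p i"
  have "(p i)\<^sup>2 \<le> K ^ 4" if "i \<in> {1..N}" for i
    using power_mono[OF p[OF that], of 2] by simp
  then have "(\<Sum>i=1..N. (p i)\<^sup>2) \<le> real (card {1..N}) * K ^ 4" by (rule sum_bounded_above)
  then have sq: "(\<Sum>i=1..N. (p i)\<^sup>2) \<le> real N * K ^ 4" by simp
  have "0 \<le> (?S - q * real N)\<^sup>2" by simp
  then have "2 * q * real N * ?S \<le> ?S\<^sup>2 + (q * real N)\<^sup>2"
    by (simp add: power2_diff algebra_simps)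
  also have "?S\<^sup>2 \<le> 2 * (\<Sum>e\<in>pairs N. p (fst e) * p (snd e)) + real N * K ^ 4"
    using sum_pairs_product[of p N] sq by linarith
  finally have "lam / (2 * real N) * (2 * q * real N * ?S)
      \<le> lam / (2 * real N) * (2 * (\<Sum>e\<in>pairs N. p (fst e) * p (snd e)) + real N * K ^ 4 + (q * real N)\<^sup>2)"
    using lam by (intro mult_left_mono) auto
  then show ?thesis using N by (simp add: field_simps power2_eq_square)
qed

section \<open>The spiked Wigner model\<close>

locale bounded_prior = real_distribution P for P :: "real measure" +
  fixes K :: real
  assumes K_nonneg: "0 \<le> K" and AE_le_K: "AE x in P. \<bar>x\<bar> \<le> K"

lemma bounded_support_imp_bounded_prior:
  assumes "real_distribution P" and "bounded (measure_support P)"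
  obtains K where "bounded_prior P K"
proof -
  interpret real_distribution P by (rule assms)
  obtain K where K: "\<And>x. x \<in> measure_support P \<Longrightarrow> \<bar>x\<bar> \<le> K"
    using assms(2) by (auto simp: bounded_iff)
  have "AE x in P. \<bar>x\<bar> \<le> max 0 K"
    using AE_measure_support[of P] K by (auto elim!: eventually_mono simp: le_max_iff_disj)
  then have "bounded_prior P (max 0 K)"
    by unfold_locales auto
  then show thesis by (rule that)
qed

context bounded_prior
begin

text \<open>The prior is bounded only almost surely; clipping gives sure bounds.\<close>

definition clip :: "real \<Rightarrow> real" where
  "clip x = max (- K) (min K x)"

lemma abs_clip_le: "\<bar>clip x\<bar> \<le> K"
  using K_nonneg by (auto simp: clip_def)

lemma clip_eq: "\<bar>x\<bar> \<le> K \<Longrightarrow> clip x = x"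
  by (auto simp: clip_def)

lemma AE_clip: "AE x in P. clip x = x"
  using AE_le_K by eventually_elim (rule clip_eq)

lemma prob_space_prior_power: "prob_space (prior_power P N)"
  by (intro prob_space_PiM prob_space_axioms)

lemma AE_clip_power: "AE x in prior_power P N. \<forall>i\<in>{1..N}. clip (x i) = x i"
proof -
  interpret Q: product_prob_space "\<lambda>_::nat. P" "{1..N}" by standard
  have "AE x in prior_power P N. clip (x i) = x i" if "i \<in> {1..N}" for i
    using that AE_clip by (intro Q.AE_component) auto
  then show ?thesis by (subst AE_finite_all) auto
qed

lemma clip_measurable [measurable]: "clip \<in> borel_measurable borel"
  unfolding clip_def by measurable

lemma component_borel_measurable:
  assumes "i \<in> {1..N}"
  shows "(\<lambda>x. x i) \<in> borel_measurable (prior_power P N)"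
proof -
  have "(\<lambda>x. x i) \<in> measurable (prior_power P N) P" using assms by (rule measurable_component_singleton)
  then show ?thesis
    by (subst measurable_cong_sets[OF refl events_eq_borel[symmetric]])
qed

lemma clip_component_measurable [measurable]:
  assumes "i \<in> {1..N}"
  shows "(\<lambda>x. clip (x i)) \<in> borel_measurable (prior_power P N)"
  using component_borel_measurable[OF assms] by measurable

text \<open>Likelihood ratio of the scalar observation \<open>y = sqrt r * x + z\<close> against
  pure noise \<open>z\<close>.\<close>

definition scalar_ratio :: "real \<Rightarrow> real \<Rightarrow> real" where
  "scalar_ratio r y = (\<integral>x. exp (sqrt r * x * y - r / 2 * x\<^sup>2) \<partial>P)"

definition scalar_moment :: "real \<Rightarrow> real \<Rightarrow> ennreal" where
  "scalar_moment u r = (\<integral>\<^sup>+y. ennreal (scalar_ratio r y powr u) \<partial>std_normal_distribution)"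

lemma scalar_ratio_clip: "scalar_ratio r y = (\<integral>x. exp (sqrt r * clip x * y - r / 2 * (clip x)\<^sup>2) \<partial>P)"
  unfolding scalar_ratio_def using AE_clip
  by (intro integral_cong_AE) (auto elim!: eventually_mono simp: measurable_cong_sets[OF events_eq_borel refl])

lemma scalar_ratio_measurable [measurable]: "scalar_ratio r \<in> borel_measurable borel"
  unfolding scalar_ratio_def by measurable

lemma scalar_weight_integrable: "integrable P (\<lambda>x. exp (sqrt r * clip x * y - r / 2 * (clip x)\<^sup>2))"
proof (rule integrable_const_bound[where B = "exp (\<bar>sqrt r\<bar> * K * \<bar>y\<bar> + \<bar>r / 2\<bar> * K\<^sup>2)"])
  have "sqrt r * clip x * y - r / 2 * (clip x)\<^sup>2 \<le> \<bar>sqrt r\<bar> * K * \<bar>y\<bar> + \<bar>r / 2\<bar> * K\<^sup>2" for x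
  proof -
    have "sqrt r * clip x * y \<le> \<bar>sqrt r\<bar> * \<bar>clip x\<bar> * \<bar>y\<bar>" by (metis abs_ge_self abs_mult)
    also have "\<dots> \<le> \<bar>sqrt r\<bar> * K * \<bar>y\<bar>"
      using abs_clip_le by (intro mult_left_mono mult_right_mono) auto
    finally have 1: "sqrt r * clip x * y \<le> \<bar>sqrt r\<bar> * K * \<bar>y\<bar>" .
    have "- (r / 2 * (clip x)\<^sup>2) \<le> \<bar>r / 2\<bar> * (clip x)\<^sup>2" by (metis abs_ge_minus_self abs_mult abs_power2)
    also have "\<dots> \<le> \<bar>r / 2\<bar> * K\<^sup>2"
      using abs_clip_le[of x] power_mono[of "\<bar>clip x\<bar>" K 2] by (intro mult_left_mono) auto
    finally show ?thesis using 1 by linarith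
  qed
  then show "AE x in P. norm (exp (sqrt r * clip x * y - r / 2 * (clip x)\<^sup>2))
      \<le> exp (\<bar>sqrt r\<bar> * K * \<bar>y\<bar> + \<bar>r / 2\<bar> * K\<^sup>2)" by simp
qed (simp add: measurable_cong_sets[OF events_eq_borel refl])

text \<open>For each fixed \<open>Y\<close> clipping changes the integrand only on a null set of the
  prior, so the two ratios agree at every observation and not only almost everywhere.\<close>

lemma likelihood_ratio_channel:
  assumes "0 \<le> lam"
  shows "likelihood_ratio P lam N Y
     = channel_ratio (prior_power P N) (pairs N)
         (\<lambda>e x. sqrt (lam / real N) * (clip (x (fst e)) * clip (x (snd e)))) Y"
proof -
  interpret Q: prob_space "prior_power P N" by (rule prob_space_prior_power)
  let ?v = "\<lambda>e x. sqrt (lam / real N) * (clip (x (fst e)) * clip (x (snd e)))"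
  have "channel_ratio (prior_power P N) (pairs N) ?v Y
      = (\<integral>x. exp (\<Sum>(i, j)\<in>pairs N. sqrt (lam / real N) * Y (i, j) * x i * x j
                  - lam / (2 * real N) * (x i)\<^sup>2 * (x j)\<^sup>2) \<partial>prior_power P N)"
    unfolding channel_ratio_def
  proof (rule integral_cong_AE)
    show "(\<lambda>x. channel_weight (pairs N) ?v x Y) \<in> borel_measurable (prior_power P N)"
      unfolding channel_weight_def using pairs_bounds[of _ _ N] by (intro borel_measurable_exp[THEN measurable_compose[rotated]] borel_measurable_sum
          borel_measurable_diff borel_measurable_times borel_measurable_const borel_measurable_divide
          borel_measurable_power clip_component_measurable) (auto simp: pairs_def)
    show "(\<lambda>x. exp (\<Sum>(i, j)\<in>pairs N. sqrt (lam / real N) * Y (i, j) * x i * x j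
                  - lam / (2 * real N) * (x i)\<^sup>2 * (x j)\<^sup>2)) \<in> borel_measurable (prior_power P N)"
      unfolding case_prod_beta
      by (intro borel_measurable_exp[THEN measurable_compose[rotated]] borel_measurable_sum
          borel_measurable_diff borel_measurable_times borel_measurable_const
          borel_measurable_power component_borel_measurable) (auto simp: pairs_def)
    show "AE x in prior_power P N. channel_weight (pairs N) ?v x Y
        = exp (\<Sum>(i, j)\<in>pairs N. sqrt (lam / real N) * Y (i, j) * x i * x j
                  - lam / (2 * real N) * (x i)\<^sup>2 * (x j)\<^sup>2)"
      using AE_clip_power
    proof eventually_elim
      case (elim x)
      show ?case
        unfolding channel_weight_def
      proof (intro arg_cong[where f = exp] sum.cong refl)
        fix e assume "e \<in> pairs N"
        then obtain i j where e: "e = (i, j)" "i \<in> {1..N}" "j \<in> {1..N}"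
          by (metis pairs_bounds surj_pair)
        then show "?v e x * Y e - (?v e x)\<^sup>2 / 2 = (case e of (i, j) \<Rightarrow> sqrt (lam / real N) * Y (i, j) * x i * x j
                  - lam / (2 * real N) * (x i)\<^sup>2 * (x j)\<^sup>2)"
          using elim assms by (simp add: power_mult_distrib field_simps)
      qed
    qed
  qed
  then show ?thesis by (simp add: likelihood_ratio_def)
qed

end

section \<open>Comparison of the matrix channel with independent scalar channels\<close>

lemma gaussian_channel_subset:
  assumes "gaussian_channel M B v K" and "A \<subseteq> B"
  shows "gaussian_channel M A v K"
proof -
  interpret gaussian_channel M B v K by (rule assms)
  show ?thesis
    using assms(2) finite_subset[OF assms(2) finite_index] signal_measurable signal_bounded
    by (intro gaussian_channel.intro gaussian_channel_axioms.intro prob_space_axioms) auto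
qed

lemma fractional_moment_cong:
  assumes "\<And>e x. e \<in> I \<Longrightarrow> x \<in> space M \<Longrightarrow> v e x = w e x"
  shows "fractional_moment u M I v = fractional_moment u M I w"
proof -
  have "channel_ratio M I v = channel_ratio M I w"
    unfolding channel_ratio_def channel_weight_def using assms
    by (intro ext Bochner_Integration.integral_cong arg_cong[where f = exp] sum.cong) auto
  then show ?thesis by (simp add: fractional_moment_def)
qed

context bounded_prior
begin

lemma scalar_ratio_pos: "0 < scalar_ratio r y"
  unfolding scalar_ratio_clip
  by (rule integral_less_AE_space[of "\<lambda>_. 0", simplified])
     (use emeasure_space_1 in \<open>auto simp: scalar_weight_integrable[simplified]\<close>)

text \<open>The hidden coordinates are independent and each is observed once, so both the ratio and
  its moment factor. The indices \<open>(i, i)\<close> let the scalar channels share an index type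
  with the matrix entries.\<close>

lemma fractional_moment_diagonal:
  assumes r: "0 \<le> r"
  shows "fractional_moment u (prior_power P N) ((\<lambda>i. (i, i)) ` {1..N}) (\<lambda>e x. sqrt r * clip (x (fst e)))
    = scalar_moment u r ^ N"
proof -
  let ?D = "(\<lambda>i. (i, i)) ` {1..N}"
  interpret Q: product_sigma_finite "\<lambda>_::nat. P" by standard
  interpret S: prob_space std_normal_distribution by (rule prob_space_std_normal)
  interpret G: product_sigma_finite "\<lambda>_::nat \<times> nat. std_normal_distribution" by standard
  have ratio: "channel_ratio (prior_power P N) ?D (\<lambda>e x. sqrt r * clip (x (fst e))) Y
      = (\<Prod>e\<in>?D. scalar_ratio r (Y e))" for Y
  proof -
    have "channel_ratio (prior_power P N) ?D (\<lambda>e x. sqrt r * clip (x (fst e))) Y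
        = (\<integral>x. (\<Prod>i=1..N. exp (sqrt r * clip (x i) * Y (i, i) - r / 2 * (clip (x i))\<^sup>2)) \<partial>prior_power P N)"
      unfolding channel_ratio_def channel_weight_def using r
      by (intro Bochner_Integration.integral_cong)
         (simp_all add: sum.reindex inj_on_def exp_sum power_mult_distrib)
    also have "\<dots> = (\<Prod>i=1..N. scalar_ratio r (Y (i, i)))"
      unfolding scalar_ratio_clip by (intro Q.product_integral_prod scalar_weight_integrable) auto
    also have "\<dots> = (\<Prod>e\<in>?D. scalar_ratio r (Y e))"
      by (simp add: prod.reindex inj_on_def)
    finally show ?thesis .
  qed
  have "fractional_moment u (prior_power P N) ?D (\<lambda>e x. sqrt r * clip (x (fst e)))
      = (\<integral>\<^sup>+Y. (\<Prod>e\<in>?D. ennreal (scalar_ratio r (Y e) powr u)) \<partial>gauss ?D)"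
    unfolding fractional_moment_def ratio
    by (simp add: prod_powr_distrib scalar_ratio_pos less_imp_le prod_ennreal)
  also have "\<dots> = (\<Prod>e\<in>?D. scalar_moment u r)"
    unfolding scalar_moment_def by (rule G.product_nn_integral_prod) auto
  also have "\<dots> = scalar_moment u r ^ N"
    by (simp add: card_image inj_on_def)
  finally show ?thesis .
qed

text \<open>The kernel comparison is applied to the matrix channel, enlarged by a constant signal,
  against \<open>N\<close> scalar channels of signal-to-noise ratio \<open>lam * q\<close>. The
  constant covers the deficit in the pointwise kernel inequality, and its explicit moment becomes
  the exponential prefactor.\<close>

lemma likelihood_fractional_moment_le:
  assumes u: "0 < u" "u < 1" and lam: "0 \<le> lam" and q: "0 \<le> q" and N: "0 < N"
  shows "(\<integral>\<^sup>+Y. ennreal (likelihood_ratio P lam N Y powr u) \<partial>noise N)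
    \<le> ennreal (exp (u * (1 - u) * (lam * real N * q\<^sup>2 / 2 + lam * K ^ 4 / 2) / 2)) * scalar_moment u (lam * q) ^ N"
proof -
  define c where "c = lam * real N * q\<^sup>2 / 2 + lam * K ^ 4 / 2"
  have c: "0 \<le> c" using lam K_nonneg by (simp add: c_def)
  let ?M = "prior_power P N"
  \<comment> \<open>One index set carries all signals: \<open>(i, j)\<close> with \<open>i < j\<close> for the matrix entries, \<open>(i, i)\<close> for the
    scalar channels, and the unused pair \<open>(0, 0)\<close> for a constant signal of strength \<open>c\<close>.\<close>
  define D where "D = (\<lambda>i::nat. (i, i)) ` {1..N}"
  define J where "J = insert (0, 0) (pairs N \<union> D)"
  define s :: "nat \<times> nat \<Rightarrow> (nat \<Rightarrow> real) \<Rightarrow> real" where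
    "s e x = (if e = (0, 0) then 1 else if fst e = snd e then clip (x (fst e))
              else clip (x (fst e)) * clip (x (snd e)))" for e x
  \<comment> \<open>\<open>b\<close> activates the matrix entries and the constant,
    \<open>b'\<close> only the scalar channels, so that the comparison concerns two choices of
    coefficients for one family of signals.\<close>
  define b :: "nat \<times> nat \<Rightarrow> real" where
    "b e = (if e = (0, 0) then c else if fst e = snd e then 0 else lam / real N)" for e
  define b' :: "nat \<times> nat \<Rightarrow> real" where
    "b' e = (if e \<noteq> (0, 0) \<and> fst e = snd e then lam * q else 0)" for e
  have disj: "(0, 0) \<notin> pairs N" "(0, 0) \<notin> D" "pairs N \<inter> D = {}"
    by (auto simp: pairs_def D_def)
  have offdiag: "fst e \<noteq> snd e" "e \<noteq> (0, 0)" "fst e \<in> {1..N}" "snd e \<in> {1..N}" if "e \<in> pairs N" for e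
    using that by (auto simp: pairs_def)
  have diag: "fst e = snd e" "e \<noteq> (0, 0)" "fst e \<in> {1..N}" if "e \<in> D" for e
    using that by (auto simp: D_def)
  have finD: "finite D" by (simp add: D_def)
  have finJ: "finite J" by (simp add: J_def finD)
  have b: "0 \<le> b e" and b': "0 \<le> b' e" for e
    using c lam q by (auto simp: b_def b'_def)
  interpret C: gaussian_channel ?M J s "1 + K + K * K"
  proof (intro gaussian_channel.intro gaussian_channel_axioms.intro prob_space_prior_power finJ)
    show "s e \<in> borel_measurable ?M" if eJ: "e \<in> J" for e
    proof -
      consider "e = (0, 0)" | "e \<in> pairs N" | "e \<in> D" using eJ by (auto simp: J_def)
      then show ?thesis
      proof cases
        case 1
        then show ?thesis by (simp add: s_def[abs_def])
      next
        case 2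
        note [measurable] = offdiag(3,4)[OF 2, THEN clip_component_measurable]
        show ?thesis using offdiag[OF 2] by (simp add: s_def[abs_def])
      next
        case 3
        note [measurable] = diag(3)[OF 3, THEN clip_component_measurable]
        show ?thesis using diag[OF 3] by (simp add: s_def[abs_def])
      qed
    qed
    show "\<bar>s e x\<bar> \<le> 1 + K + K * K" for e x
    proof -
      have "\<bar>clip (x (fst e)) * clip (x (snd e))\<bar> \<le> K * K"
        unfolding abs_mult using abs_clip_le K_nonneg by (intro mult_mono) auto
      moreover have "0 \<le> K * K" using K_nonneg by simp
      ultimately have "\<bar>clip (x (fst e)) * clip (x (snd e))\<bar> \<le> 1 + K + K * K"
        "\<bar>clip (x (fst e))\<bar> \<le> 1 + K + K * K" "1 \<le> 1 + K + K * K"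
        using abs_clip_le[of "x (fst e)"] K_nonneg by linarith+
      moreover have "s e x = 1 \<or> s e x = clip (x (fst e)) \<or> s e x = clip (x (fst e)) * clip (x (snd e))"
        by (simp add: s_def)
      ultimately show ?thesis by (elim disjE) simp_all
    qed
  qed
  let ?vL = "\<lambda>e x. sqrt (lam / real N) * (clip (x (fst e)) * clip (x (snd e)))"
  note chan = C.scaled_channel[of b, OF b] C.scaled_channel[of b', OF b']
  have "fractional_moment u ?M J (scaled_signal b s) = fractional_moment u ?M (insert (0, 0) (pairs N)) (scaled_signal b s)"
  proof (rule fractional_moment_zero_signals[OF gaussian_channel_subset[OF chan(1)] finJ])
    show "sqrt (b e) * s e x = 0" if "e \<in> J - insert (0, 0) (pairs N)" for e x
      using that diag[of e] by (auto simp: b_def J_def)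
  qed (auto simp: J_def)
  also have "\<dots> = ennreal (exp (- u * (1 - u) * (sqrt c)\<^sup>2 / 2)) * fractional_moment u ?M (pairs N) (scaled_signal b s)"
    by (rule fractional_moment_constant_signal[OF gaussian_channel_subset[OF chan(1)] disj(1)])
       (auto simp: J_def b_def s_def)
  also have "fractional_moment u ?M (pairs N) (scaled_signal b s) = fractional_moment u ?M (pairs N) ?vL"
    by (rule fractional_moment_cong) (use offdiag in \<open>auto simp: b_def s_def\<close>)
  also have "(sqrt c)\<^sup>2 = c" using c by simp
  finally have lhs: "fractional_moment u ?M J (scaled_signal b s)
      = ennreal (exp (- u * (1 - u) * c / 2)) * fractional_moment u ?M (pairs N) ?vL" .
  have "fractional_moment u ?M J (scaled_signal b' s) = fractional_moment u ?M D (scaled_signal b' s)"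
  proof (rule fractional_moment_zero_signals[OF gaussian_channel_subset[OF chan(2)] finJ])
    show "sqrt (b' e) * s e x = 0" if "e \<in> J - D" for e x
      using that offdiag[of e] by (auto simp: b'_def J_def)
  qed (auto simp: J_def)
  also have "\<dots> = fractional_moment u ?M D (\<lambda>e x. sqrt (lam * q) * clip (x (fst e)))"
    by (rule fractional_moment_cong) (use diag in \<open>auto simp: b'_def s_def\<close>)
  also have "\<dots> = scalar_moment u (lam * q) ^ N"
    unfolding D_def using lam q by (intro fractional_moment_diagonal) auto
  finally have rhs: "fractional_moment u ?M J (scaled_signal b' s) = scalar_moment u (lam * q) ^ N" .
  have "fractional_moment u ?M J (scaled_signal b s) \<le> fractional_moment u ?M J (scaled_signal b' s)"
  proof (rule C.fractional_moment_antimono[OF u b b'])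
    fix x x' :: "nat \<Rightarrow> real"
    let ?p = "\<lambda>i. clip (x i) * clip (x' i)"
    have sumJ: "(\<Sum>e\<in>J. f e) = f (0, 0) + ((\<Sum>e\<in>pairs N. f e) + (\<Sum>e\<in>D. f e))" for f :: "nat \<times> nat \<Rightarrow> real"
      unfolding J_def using disj finD by (simp add: sum.union_disjoint)
    have 1: "(\<Sum>e\<in>J. b' e * s e x * s e x') = lam * q * (\<Sum>i=1..N. ?p i)"
    proof -
      have "(\<Sum>e\<in>pairs N. b' e * s e x * s e x') = 0"
        using offdiag by (intro sum.neutral) (auto simp: b'_def)
      moreover have "(\<Sum>e\<in>D. b' e * s e x * s e x') = (\<Sum>i=1..N. lam * q * ?p i)"
        unfolding D_def by (simp add: sum.reindex inj_on_def b'_def s_def mult_ac)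
      ultimately show ?thesis unfolding sumJ by (simp add: b'_def sum_distrib_left)
    qed
    have 2: "(\<Sum>e\<in>J. b e * s e x * s e x') = lam / real N * (\<Sum>e\<in>pairs N. ?p (fst e) * ?p (snd e)) + c"
    proof -
      have "(\<Sum>e\<in>D. b e * s e x * s e x') = 0"
        using diag by (intro sum.neutral) (auto simp: b_def)
      moreover have "(\<Sum>e\<in>pairs N. b e * s e x * s e x') = (\<Sum>e\<in>pairs N. lam / real N * (?p (fst e) * ?p (snd e)))"
        by (rule sum.cong[OF refl]) (use offdiag in \<open>auto simp: b_def s_def\<close>)
      ultimately show ?thesis unfolding sumJ by (simp add: b_def s_def sum_distrib_left)
    qed
    have "\<bar>?p i\<bar> \<le> K\<^sup>2" for i
      unfolding abs_mult power2_eq_square using abs_clip_le K_nonneg by (intro mult_mono) auto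
    then show "(\<Sum>e\<in>J. b' e * s e x * s e x') \<le> (\<Sum>e\<in>J. b e * s e x * s e x')"
      unfolding 1 2 c_def using lam N by (intro pair_kernel_lower_bound) auto
  qed
  \<comment> \<open>Multiplication by the inverse of the factor of the constant signal isolates the
    matrix channel.\<close>
  then have "ennreal (exp (u * (1 - u) * c / 2)) * (ennreal (exp (- u * (1 - u) * c / 2)) * fractional_moment u ?M (pairs N) ?vL)
      \<le> ennreal (exp (u * (1 - u) * c / 2)) * scalar_moment u (lam * q) ^ N"
    unfolding lhs rhs by (rule mult_left_mono) simp
  moreover have "ennreal (exp (u * (1 - u) * c / 2)) * ennreal (exp (- u * (1 - u) * c / 2)) = 1"
    by (simp add: ennreal_mult'[symmetric] exp_add[symmetric])
  ultimately show ?thesis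
    by (simp add: mult.assoc[symmetric] likelihood_ratio_channel[OF lam] fractional_moment_def c_def)
qed

section \<open>The scalar fractional moment near exponent one\<close>

lemma abs_ln_scalar_ratio_le:
  assumes r: "0 \<le> r"
  shows "\<bar>ln (scalar_ratio r y)\<bar> \<le> sqrt r * K * \<bar>y\<bar> + r / 2 * K\<^sup>2"
proof -
  let ?h = "\<lambda>x. sqrt r * clip x * y - r / 2 * (clip x)\<^sup>2"
  have lin: "\<bar>sqrt r * clip x * y\<bar> \<le> sqrt r * K * \<bar>y\<bar>" for x
    unfolding abs_mult using abs_clip_le r by (auto intro!: mult_left_mono mult_right_mono)
  have sq: "0 \<le> r / 2 * (clip x)\<^sup>2" "r / 2 * (clip x)\<^sup>2 \<le> r / 2 * K\<^sup>2" for x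
    using r abs_clip_le[of x] power_mono[of "\<bar>clip x\<bar>" K 2] by (auto intro!: mult_left_mono)
  have "scalar_ratio r y \<le> exp (sqrt r * K * \<bar>y\<bar>)"
    unfolding scalar_ratio_clip
  proof (rule integral_le_const[OF scalar_weight_integrable], rule AE_I2)
    show "exp (?h x) \<le> exp (sqrt r * K * \<bar>y\<bar>)" for x
      using lin[of x] sq[of x] by simp
  qed
  then have up: "ln (scalar_ratio r y) \<le> sqrt r * K * \<bar>y\<bar>"
    using scalar_ratio_pos[of r y] by (metis ln_exp ln_le_cancel_iff exp_gt_zero)
  have "exp (- (sqrt r * K * \<bar>y\<bar> + r / 2 * K\<^sup>2)) \<le> scalar_ratio r y"
    unfolding scalar_ratio_clip
  proof (rule integral_ge_const[OF scalar_weight_integrable], rule AE_I2)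
    show "exp (- (sqrt r * K * \<bar>y\<bar> + r / 2 * K\<^sup>2)) \<le> exp (?h x)" for x
      using lin[of x] sq[of x] by simp
  qed
  then have lo: "- (sqrt r * K * \<bar>y\<bar> + r / 2 * K\<^sup>2) \<le> ln (scalar_ratio r y)"
    using scalar_ratio_pos[of r y] by (metis ln_exp ln_le_cancel_iff exp_gt_zero)
  have "0 \<le> r / 2 * K\<^sup>2" using r by simp
  then show ?thesis using up lo by linarith
qed

end

text \<open>Passage from sets to functions in \<open>std_normal_shift\<close>: the exponential tilt
  is the density of the translated Gaussian.\<close>

lemma nn_integral_std_normal_shift:
  assumes f [measurable]: "f \<in> borel_measurable borel"
  shows "(\<integral>\<^sup>+y. ennreal (exp (t * y - t\<^sup>2 / 2)) * f y \<partial>std_normal_distribution)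
       = (\<integral>\<^sup>+w. f (t + w) \<partial>std_normal_distribution)"
proof -
  have "distr std_normal_distribution borel (\<lambda>w. t + w)
      = density std_normal_distribution (\<lambda>y. ennreal (exp (t * y - t\<^sup>2 / 2)))" (is "?D = ?E")
  proof (rule measure_eqI)
    fix A assume "A \<in> sets ?D"
    then have A [measurable]: "A \<in> sets borel" by simp
    have "emeasure ?E A = (\<integral>\<^sup>+y. indicator A y * ennreal (exp (t * y - t\<^sup>2 / 2)) \<partial>std_normal_distribution)"
      by (subst emeasure_density) (auto simp: mult.commute)
    then show "emeasure ?D A = emeasure ?E A"
      by (simp add: std_normal_shift emeasure_distr)
  qed simp
  then have "(\<integral>\<^sup>+w. f w \<partial>?D) = (\<integral>\<^sup>+y. f y \<partial>?E)" by simp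
  then show ?thesis by (simp add: nn_integral_distr nn_integral_density)
qed

text \<open>Second-order Taylor formula with Lagrange remainder. The quadratic factor is absorbed
  into a second \<open>exp \<bar>X\<bar>\<close>, so that the remainder is \<open>s\<^sup>2\<close>
  times a quantity free of \<open>s\<close>.\<close>

lemma exp_neg_scaled_le:
  fixes s X :: real
  assumes s: "0 \<le> s" "s \<le> 1"
  shows "exp (- s * X) \<le> 1 - s * X + s\<^sup>2 * exp (2 * \<bar>X\<bar>)"
proof -
  obtain t where t: "\<bar>t\<bar> \<le> \<bar>- s * X\<bar>" "exp (- s * X) = (\<Sum>m<2. (- s * X) ^ m / fact m) + exp t / fact 2 * (- s * X) ^ 2"
    using Maclaurin_exp_le[of "- s * X" 2] by blast
  have "\<bar>- s * X\<bar> \<le> \<bar>X\<bar>" using s by (simp add: abs_mult mult_left_le_one_le)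
  then have "exp t \<le> exp \<bar>X\<bar>" using t(1) by simp
  moreover have "X\<^sup>2 / 2 \<le> exp \<bar>X\<bar>"
    using exp_lower_Taylor_quadratic[of "\<bar>X\<bar>"] by simp
  ultimately have "exp t * (X\<^sup>2 / 2) \<le> exp \<bar>X\<bar> * exp \<bar>X\<bar>"
    by (intro mult_mono) auto
  also have "\<dots> = exp (2 * \<bar>X\<bar>)" by (simp add: exp_add[symmetric])
  finally have "s\<^sup>2 * (exp t * (X\<^sup>2 / 2)) \<le> s\<^sup>2 * exp (2 * \<bar>X\<bar>)" by (rule mult_left_mono) simp
  moreover have "exp (- s * X) = 1 - s * X + s\<^sup>2 * (exp t * (X\<^sup>2 / 2))"
    using t(2) by (simp add: numeral_2_eq_2 power_mult_distrib) 
  ultimately show ?thesis by linarith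
qed

context bounded_prior
begin

text \<open>The power \<open>1 - s\<close> of the ratio is the ratio times its power
  \<open>- s\<close>, and the first factor is the density that turns noise into the observation
  \<open>sqrt r * x + z\<close>.\<close>

lemma scalar_moment_change_of_measure:
  assumes r: "0 \<le> r"
  shows "scalar_moment (1 - s) r
    = (\<integral>\<^sup>+p. ennreal (exp (- s * ln (scalar_ratio r (sqrt r * fst p + snd p)))) \<partial>(P \<Otimes>\<^sub>M std_normal_distribution))"
proof -
  interpret S: prob_space std_normal_distribution by (rule prob_space_std_normal)
  interpret PS: pair_prob_space P std_normal_distribution by standard
  let ?w = "\<lambda>x y. ennreal (exp ((sqrt r * clip x) * y - (sqrt r * clip x)\<^sup>2 / 2))"
  let ?g = "\<lambda>y. ennreal (scalar_ratio r y powr - s)"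
  note [measurable_cong] = events_eq_borel
  have z: "ennreal (scalar_ratio r y) = (\<integral>\<^sup>+x. ?w x y \<partial>P)" for y
    unfolding scalar_ratio_clip using r
    by (subst nn_integral_eq_integral[symmetric])
       (auto simp: scalar_weight_integrable[simplified] power_mult_distrib mult.assoc[symmetric] intro!: nn_integral_cong)
  have "scalar_moment (1 - s) r = (\<integral>\<^sup>+y. (\<integral>\<^sup>+x. ?w x y * ?g y \<partial>P) \<partial>std_normal_distribution)"
    unfolding scalar_moment_def
  proof (intro nn_integral_cong)
    fix y
    have "scalar_ratio r y powr (1 - s) = scalar_ratio r y * scalar_ratio r y powr - s"
      using scalar_ratio_pos[of r y] by (simp add: powr_diff powr_minus divide_inverse)
    then have "ennreal (scalar_ratio r y powr (1 - s)) = ennreal (scalar_ratio r y) * ?g y"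
      using scalar_ratio_pos[of r y] by (simp add: ennreal_mult)
    then show "ennreal (scalar_ratio r y powr (1 - s)) = (\<integral>\<^sup>+x. ?w x y * ?g y \<partial>P)"
      by (simp add: z nn_integral_multc)
  qed
  also have "\<dots> = (\<integral>\<^sup>+x. (\<integral>\<^sup>+y. ?w x y * ?g y \<partial>std_normal_distribution) \<partial>P)"
    by (rule PS.Fubini') measurable
  also have "\<dots> = (\<integral>\<^sup>+x. (\<integral>\<^sup>+w. ?g (sqrt r * clip x + w) \<partial>std_normal_distribution) \<partial>P)"
    by (intro nn_integral_cong nn_integral_std_normal_shift) measurable
  also have "\<dots> = (\<integral>\<^sup>+x. (\<integral>\<^sup>+w. ?g (sqrt r * x + w) \<partial>std_normal_distribution) \<partial>P)"
    using AE_clip by (intro nn_integral_cong_AE) (auto elim!: eventually_mono)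
  also have "\<dots> = (\<integral>\<^sup>+p. ?g (sqrt r * fst p + snd p) \<partial>(P \<Otimes>\<^sub>M std_normal_distribution))"
    by (subst S.nn_integral_fst[symmetric]) auto
  also have "\<dots> = (\<integral>\<^sup>+p. ennreal (exp (- s * ln (scalar_ratio r (sqrt r * fst p + snd p)))) \<partial>(P \<Otimes>\<^sub>M std_normal_distribution))"
    using scalar_ratio_pos by (intro nn_integral_cong) (simp add: powr_def less_imp_neq[THEN not_sym])
  finally show ?thesis .
qed

text \<open>Substituting \<open>y = sqrt r * xs + z\<close> exhibits \<open>psi\<close> as the mean
  log-likelihood ratio under the spiked scalar law, that is, the relative entropy of that law with
  respect to the null.\<close>

lemma psi_eq_ln_scalar_ratio:
  assumes "0 \<le> r"
  shows "psi P r = (\<integral>p. ln (scalar_ratio r (sqrt r * fst p + snd p)) \<partial>(P \<Otimes>\<^sub>M std_normal_distribution))"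
proof -
  have "sqrt r * z * x + r * x * xs - r / 2 * x\<^sup>2 = sqrt r * x * (sqrt r * xs + z) - r / 2 * x\<^sup>2" for z x xs
  proof -
    have "sqrt r * x * (sqrt r * xs) = (sqrt r * sqrt r) * x * xs" by (simp only: mult_ac)
    then show ?thesis using assms by (simp add: distrib_left mult_ac)
  qed
  then show ?thesis unfolding psi_def scalar_ratio_def by (simp add: split_beta')
qed

text \<open>Under the spiked scalar law the log ratio \<open>X\<close> has mean
  \<open>psi P r\<close>, and its exponential moments bound the second-order remainder of
  \<open>exp (- s * X)\<close> uniformly in \<open>s\<close>.\<close>

lemma scalar_moment_le:
  assumes r: "0 \<le> r"
  shows "\<exists>B\<ge>0. \<forall>s. 0 \<le> s \<and> s \<le> 1 \<longrightarrow> scalar_moment (1 - s) r \<le> ennreal (exp (- s * psi P r + s\<^sup>2 * B))"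
proof -
  interpret S: prob_space std_normal_distribution by (rule prob_space_std_normal)
  interpret PS: pair_prob_space P std_normal_distribution by standard
  let ?PS = "P \<Otimes>\<^sub>M std_normal_distribution"
  note [measurable_cong] = events_eq_borel
  define X where "X p = ln (scalar_ratio r (sqrt r * fst p + snd p))" for p
  \<comment> \<open>For a prior value within \<open>K\<close> the bound on the log ratio gives
    \<open>2 * \<bar>X p\<bar> \<le> 3 * r * K\<^sup>2 + c * \<bar>snd p\<bar>\<close>;
    \<open>g\<close> dominates the exponential of this by adding up both signs of the noise.\<close>
  define c where "c = 2 * (sqrt r * K)"
  define g where "g y = exp (3 * r * K\<^sup>2) * (exp (c * y) + exp (- c * y))" for y
  have [measurable]: "X \<in> borel_measurable ?PS" unfolding X_def by measurable
  have exp_int: "integrable std_normal_distribution (\<lambda>y. exp (t * y))" for t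
    using nn_integral_std_normal_exp[of t] by (intro integrableI_nonneg) auto
  have "integrable std_normal_distribution g"
    unfolding g_def using exp_int[of c] exp_int[of "- c"] by auto
  then have "integrable (distr ?PS std_normal_distribution snd) g"
    by (simp add: distr_pair_snd prob_space_axioms S.sigma_finite_measure_axioms)
  then have gint: "integrable ?PS (\<lambda>p. g (snd p))"
    by (rule integrable_distr[rotated]) measurable
  have "distr ?PS P fst = P" by (rule S.distr_pair_fst)
  then have "AE x in distr ?PS P fst. \<bar>x\<bar> \<le> K"
    using AE_le_K by (simp only:)
  then have AEfst: "AE p in ?PS. \<bar>fst p\<bar> \<le> K"
    by (subst (asm) AE_distr_iff) auto
  have Xg: "AE p in ?PS. exp (2 * \<bar>X p\<bar>) \<le> g (snd p)"
    using AEfst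
  proof eventually_elim
    case (elim p)
    have "\<bar>X p\<bar> \<le> sqrt r * K * \<bar>sqrt r * fst p + snd p\<bar> + r / 2 * K\<^sup>2"
      unfolding X_def by (rule abs_ln_scalar_ratio_le[OF r])
    also have "\<bar>sqrt r * fst p + snd p\<bar> \<le> sqrt r * K + \<bar>snd p\<bar>"
    proof -
      have "\<bar>sqrt r * fst p\<bar> \<le> sqrt r * K" using elim r by (simp add: abs_mult mult_left_mono)
      then show ?thesis by linarith
    qed
    then have "sqrt r * K * \<bar>sqrt r * fst p + snd p\<bar> \<le> sqrt r * K * (sqrt r * K + \<bar>snd p\<bar>)"
      using r K_nonneg by (intro mult_left_mono) auto
    also have "\<dots> = r * K\<^sup>2 + sqrt r * K * \<bar>snd p\<bar>"
    proof -
      have "sqrt r * K * (sqrt r * K) = (sqrt r * sqrt r) * (K * K)" by (simp only: mult_ac)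
      then show ?thesis using r by (simp add: distrib_left power2_eq_square)
    qed
    finally have "2 * \<bar>X p\<bar> \<le> 3 * r * K\<^sup>2 + c * \<bar>snd p\<bar>" by (simp add: c_def)
    then have "exp (2 * \<bar>X p\<bar>) \<le> exp (3 * r * K\<^sup>2) * exp (c * \<bar>snd p\<bar>)"
      by (simp add: exp_add[symmetric])
    also have "exp (c * \<bar>snd p\<bar>) \<le> exp (c * snd p) + exp (- c * snd p)"
      by (cases "0 \<le> snd p") (auto intro: add_increasing add_increasing2)
    finally show ?case by (simp add: g_def)
  qed
  have Xint: "integrable ?PS X"
  proof (rule Bochner_Integration.integrable_bound[OF gint])
    show "AE p in ?PS. norm (X p) \<le> norm (g (snd p))"
      using Xg
    proof eventually_elim
      case (elim p)
      have "\<bar>X p\<bar> \<le> exp (2 * \<bar>X p\<bar>)" using exp_ge_add_one_self[of "2 * \<bar>X p\<bar>"] by linarith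
      then show ?case using elim by simp
    qed
  qed measurable
  define B where "B = (\<integral>p. g (snd p) \<partial>?PS)"
  have "0 \<le> B" unfolding B_def g_def by (intro integral_nonneg_AE) auto
  moreover have "scalar_moment (1 - s) r \<le> ennreal (exp (- s * psi P r + s\<^sup>2 * B))"
    if s: "0 \<le> s" "s \<le> 1" for s
  proof -
    let ?f = "\<lambda>p. 1 - s * X p + s\<^sup>2 * g (snd p)"
    have le: "AE p in ?PS. exp (- s * X p) \<le> ?f p"
      using Xg
    proof eventually_elim
      case (elim p)
      have "exp (- s * X p) \<le> 1 - s * X p + s\<^sup>2 * exp (2 * \<bar>X p\<bar>)"
        by (rule exp_neg_scaled_le[OF s])
      also have "s\<^sup>2 * exp (2 * \<bar>X p\<bar>) \<le> s\<^sup>2 * g (snd p)" using elim by (rule mult_left_mono) simp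
      finally show ?case by simp
    qed
    have "scalar_moment (1 - s) r = (\<integral>\<^sup>+p. ennreal (exp (- s * X p)) \<partial>?PS)"
      unfolding scalar_moment_change_of_measure[OF r] X_def ..
    also have "\<dots> \<le> (\<integral>\<^sup>+p. ennreal (?f p) \<partial>?PS)"
      using le by (intro nn_integral_mono_AE) (auto elim!: eventually_mono intro: ennreal_leI)
    also have "\<dots> = ennreal (\<integral>p. ?f p \<partial>?PS)"
    proof (rule nn_integral_eq_integral)
      show "integrable ?PS ?f" using Xint gint by auto
      show "AE p in ?PS. 0 \<le> ?f p"
        using le by eventually_elim (use exp_ge_zero order_trans in blast)
    qed
    also have "(\<integral>p. ?f p \<partial>?PS) = 1 + (- s * psi P r + s\<^sup>2 * B)"
      using Xint gint by (simp add: B_def psi_eq_ln_scalar_ratio[OF r] X_def[symmetric] PS.prob_space)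
    \<comment> \<open>The exponential form suits the later passage to the power
      \<open>N\<close>.\<close>
    also have "ennreal \<dots> \<le> ennreal (exp (- s * psi P r + s\<^sup>2 * B))"
      by (intro ennreal_leI exp_ge_add_one_self)
    finally show ?thesis .
  qed
  ultimately show ?thesis by blast
qed

end

section \<open>Tails of the likelihood ratio and orthogonality\<close>

lemma spiked_wigner_zero:
  assumes "prob_space P"
  shows "spiked_wigner P 0 N = noise N"
proof -
  interpret P: prob_space P by (rule assms)
  interpret G: prob_space "noise N" by (rule prob_space_gauss)
  have Q: "prob_space (prior_power P N)" by (intro prob_space_PiM P.prob_space_axioms)
  have "spiked_wigner P 0 N = distr (prior_power P N \<Otimes>\<^sub>M noise N) (noise N) snd"
    unfolding spiked_wigner_def
  proof (rule distr_cong[OF refl])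
    fix p assume "p \<in> space (prior_power P N \<Otimes>\<^sub>M noise N)"
    then have "snd p \<in> extensional (pairs N)"
      by (auto simp: space_pair_measure space_PiM PiE_def)
    then show "(case p of (x, W) \<Rightarrow> \<lambda>(i, j)\<in>pairs N. sqrt (0 / real N) * x i * x j + W (i, j)) = snd p"
      by (auto simp: fun_eq_iff case_prod_beta extensional_def restrict_def)
  qed (simp add: sets_gauss)
  also have "\<dots> = noise N"
    by (rule distr_pair_snd[OF Q G.sigma_finite_measure_axioms])
  finally show ?thesis .
qed

context bounded_prior
begin

lemma likelihood_ratio_properties:
  assumes lam: "0 \<le> lam"
  shows likelihood_ratio_pos: "0 < likelihood_ratio P lam N Y"
    and likelihood_ratio_measurable: "likelihood_ratio P lam N \<in> borel_measurable (noise N)"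
    and nn_integral_likelihood_ratio: "(\<integral>\<^sup>+Y. ennreal (likelihood_ratio P lam N Y) \<partial>noise N) = 1"
proof -
  let ?v = "\<lambda>e x. sqrt (lam / real N) * (clip (x (fst e)) * clip (x (snd e)))"
  interpret C: gaussian_channel "prior_power P N" "pairs N" ?v "sqrt (lam / real N) * (K * K)"
  proof (intro gaussian_channel.intro gaussian_channel_axioms.intro prob_space_prior_power)
    fix e assume "e \<in> pairs N"
    then have [measurable]: "fst e \<in> {1..N}" "snd e \<in> {1..N}" by (auto simp: pairs_def)
    show "?v e \<in> borel_measurable (prior_power P N)" by measurable
    have "\<bar>clip (x (fst e)) * clip (x (snd e))\<bar> \<le> K * K" for x :: "nat \<Rightarrow> real"
      unfolding abs_mult using abs_clip_le K_nonneg by (intro mult_mono) auto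
    then show "\<bar>?v e x\<bar> \<le> sqrt (lam / real N) * (K * K)" for x
      using lam by (subst abs_mult) (auto intro!: mult_left_mono)
  qed simp
  show "0 < likelihood_ratio P lam N Y"
    unfolding likelihood_ratio_channel[OF lam] by (rule C.ratio_pos)
  show "likelihood_ratio P lam N \<in> borel_measurable (noise N)"
    using C.ratio_measurable by (simp add: likelihood_ratio_channel[OF lam, abs_def])
  show "(\<integral>\<^sup>+Y. ennreal (likelihood_ratio P lam N Y) \<partial>noise N) = 1"
    unfolding likelihood_ratio_channel[OF lam] by (rule C.nn_integral_ratio)
qed

end

lemma exp_linear_decay_tendsto_0:
  fixes C a :: real
  assumes "0 < a"
  shows "(\<lambda>N. C * exp (- (real N * a))) \<longlonglongrightarrow> 0"
proof -
  have "(\<lambda>N. C * exp (- a) ^ N) \<longlonglongrightarrow> C * 0"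
    using assms by (intro tendsto_mult tendsto_const LIMSEQ_realpow_zero) auto
  then show ?thesis by (simp add: exp_of_nat_mult[symmetric])
qed

text \<open>Markov's inequality for the power \<open>- s\<close> of the ratio. With \<open>F\<close>
  the value of the potential, the threshold contributes \<open>s * F / 4\<close> per coordinate and
  the fractional moment at most \<open>- s * F / 2\<close>, which leaves a decay rate of
  \<open>s * F / 4\<close>.\<close>

lemma likelihood_ratio_lower_tail:
  assumes P: "real_distribution P" and bdd: "bounded (measure_support P)"
    and lam: "0 < lam" and q: "0 \<le> q" and F: "0 < RS_potential P lam q"
  shows "(\<lambda>N. measure (spiked_wigner P lam N)
      {Y \<in> space (spiked_wigner P lam N). likelihood_ratio P lam N Y \<le> exp (real N * (RS_potential P lam q / 4))})
    \<longlonglongrightarrow> 0"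
proof -
  obtain K where "bounded_prior P K" by (rule bounded_support_imp_bounded_prior[OF P bdd])
  then interpret bounded_prior P K .
  let ?F = "RS_potential P lam q"
  let ?r = "lam * q"
  have lam0: "0 \<le> lam" and r: "0 \<le> ?r" using lam q by auto
  note Lpos = likelihood_ratio_pos[OF lam0]
  note [measurable] = likelihood_ratio_measurable[OF lam0]
  obtain B where B: "0 \<le> B"
    and mom: "\<And>s. 0 \<le> s \<Longrightarrow> s \<le> 1 \<Longrightarrow> scalar_moment (1 - s) ?r \<le> ennreal (exp (- s * psi P ?r + s\<^sup>2 * B))"
    using scalar_moment_le[OF r] by blast
  \<comment> \<open>The cap 1/2 keeps \<open>1 - s\<close> strictly between 0 and 1; the other bound
    makes the quadratic error at most half of the linear gain, with \<open>B + 1\<close> to rule out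
    a zero denominator.\<close>
  define s where "s = min (1 / 2) (?F / (2 * (B + 1)))"
  have s: "0 < s" "s < 1" using F B by (auto simp: s_def)
  have sB: "s * B \<le> ?F / 2"
  proof -
    have "s * B \<le> ?F / (2 * (B + 1)) * (B + 1)"
      using B s by (intro mult_mono) (auto simp: s_def)
    also have "\<dots> = ?F / 2" using B by (simp add: field_simps)
    finally show ?thesis .
  qed
  \<comment> \<open>The factor that does not grow with \<open>N\<close>, caused by the missing
    diagonal.\<close>
  define C where "C = exp (s * (lam * K ^ 4 / 4))"
  let ?A = "\<lambda>N. {Y \<in> space (spiked_wigner P lam N). likelihood_ratio P lam N Y \<le> exp (real N * (?F / 4))}"
  have bound: "measure (spiked_wigner P lam N) (?A N) \<le> C * exp (- (real N * (s * ?F / 4)))" if N: "0 < N" for N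
  proof -
    let ?L = "likelihood_ratio P lam N"
    let ?e = "exp (real N * (?F / 4))"
    have dens: "spiked_wigner P lam N = density (noise N) (\<lambda>Y. ennreal (?L Y))"
      using spiked_wigner_density[OF P bdd lam0] by (simp add: spiked_wigner_zero prob_space_axioms)
    have A [measurable]: "?A N \<in> sets (noise N)" unfolding dens by simp
    have "(\<integral>\<^sup>+Y. ennreal (?L Y powr (1 - s)) \<partial>noise N)
        \<le> ennreal (exp ((1 - s) * (1 - (1 - s)) * (lam * real N * q\<^sup>2 / 2 + lam * K ^ 4 / 2) / 2)) * scalar_moment (1 - s) ?r ^ N"
      using s by (intro likelihood_fractional_moment_le lam0 q N) auto
    also have "\<dots> \<le> ennreal (exp (s * (lam * real N * q\<^sup>2 / 2 + lam * K ^ 4 / 2) / 2))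
        * ennreal (exp (- s * psi P ?r + s\<^sup>2 * B)) ^ N"
    proof (intro mult_mono power_mono mom ennreal_leI)
      have "(1 - s) * s * (lam * real N * q\<^sup>2 / 2 + lam * K ^ 4 / 2) \<le> s * (lam * real N * q\<^sup>2 / 2 + lam * K ^ 4 / 2)"
        using s lam by (intro mult_right_mono) (auto simp: mult_left_le_one_le)
      then show "exp ((1 - s) * (1 - (1 - s)) * (lam * real N * q\<^sup>2 / 2 + lam * K ^ 4 / 2) / 2)
          \<le> exp (s * (lam * real N * q\<^sup>2 / 2 + lam * K ^ 4 / 2) / 2)" by simp
    qed (use s in auto)
    also have "\<dots> = ennreal (exp (s * (lam * real N * q\<^sup>2 / 2 + lam * K ^ 4 / 2) / 2)
        * exp (real N * (- s * psi P ?r + s\<^sup>2 * B)))"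
      by (simp add: ennreal_power ennreal_mult'[symmetric] exp_of_nat_mult)
    \<comment> \<open>The term \<open>lam * q\<^sup>2 / 4\<close> of the prefactor joins
      \<open>psi\<close> to form the potential \<open>?F\<close>.\<close>
    also have "exp (s * (lam * real N * q\<^sup>2 / 2 + lam * K ^ 4 / 2) / 2) * exp (real N * (- s * psi P ?r + s\<^sup>2 * B))
        = C * exp (real N * (s * (s * B - ?F)))"
      unfolding C_def exp_add[symmetric] RS_potential_def
      by (intro arg_cong[where f = exp]) (simp add: field_simps power2_eq_square)
    also have "ennreal \<dots> \<le> ennreal (C * exp (real N * (s * (- (?F / 2)))))"
    proof -
      have "s * (s * B - ?F) \<le> s * (- (?F / 2))"
        using sB s by (intro mult_left_mono) auto
      then have "real N * (s * (s * B - ?F)) \<le> real N * (s * (- (?F / 2)))"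
        by (rule mult_left_mono) simp
      then show ?thesis by (intro ennreal_leI mult_left_mono) (simp_all add: C_def)
    qed
    finally have moment: "(\<integral>\<^sup>+Y. ennreal (?L Y powr (1 - s)) \<partial>noise N) \<le> ennreal (C * exp (real N * (s * (- (?F / 2)))))" .
    have "emeasure (spiked_wigner P lam N) (?A N) = (\<integral>\<^sup>+Y. ennreal (?L Y) * indicator (?A N) Y \<partial>noise N)"
      using A unfolding dens by (subst emeasure_density) auto
    also have "\<dots> \<le> (\<integral>\<^sup>+Y. ennreal (?e powr s) * ennreal (?L Y powr (1 - s)) \<partial>noise N)"
    proof (intro nn_integral_mono)
      fix Y
      show "ennreal (?L Y) * indicator (?A N) Y \<le> ennreal (?e powr s) * ennreal (?L Y powr (1 - s))"
      proof (cases "Y \<in> ?A N")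
        case True
        \<comment> \<open>On the event the factor \<open>?L Y powr s\<close> is at most
          \<open>?e powr s\<close>; the other factor is the fractional moment under the
          noise.\<close>
        have "?L Y = ?L Y powr s * ?L Y powr (1 - s)"
          using Lpos[of N Y] by (simp add: powr_add[symmetric])
        also have "\<dots> \<le> ?e powr s * ?L Y powr (1 - s)"
          using True Lpos[of N Y] s by (intro mult_right_mono powr_mono2) auto
        finally show ?thesis using True by (simp add: ennreal_mult[symmetric] ennreal_leI)
      qed simp
    qed
    also have "\<dots> = ennreal (?e powr s) * (\<integral>\<^sup>+Y. ennreal (?L Y powr (1 - s)) \<partial>noise N)"
      by (rule nn_integral_cmult) measurable
    also have "\<dots> \<le> ennreal (?e powr s) * ennreal (C * exp (real N * (s * (- (?F / 2)))))"
      by (intro mult_left_mono moment) simp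
    also have "\<dots> = ennreal (?e powr s * (C * exp (real N * (s * (- (?F / 2))))))"
      by (rule ennreal_mult'[symmetric]) simp
    also have "?e powr s * (C * exp (real N * (s * (- (?F / 2))))) = C * exp (- (real N * (s * ?F / 4)))"
      by (simp add: powr_def exp_add[symmetric] mult.left_commute[of _ C] field_simps)
    finally show ?thesis
      unfolding measure_def by (auto intro!: enn2real_leI simp: C_def)
  qed
  show ?thesis
  proof (rule tendsto_sandwich[OF _ _ tendsto_const exp_linear_decay_tendsto_0])
    show "\<forall>\<^sub>F N in sequentially. measure (spiked_wigner P lam N) (?A N) \<le> C * exp (- (real N * (s * ?F / 4)))"
      using eventually_gt_at_top[of 0] by eventually_elim (rule bound)
  qed (use s F in auto)
qed

theorem proposition4:
  fixes P :: "real measure" and lam :: real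
  assumes prior: "real_distribution P"
    and bounded_prior: "bounded (measure_support P)"
    and above_threshold: "lambda_c P < ereal lam"
  shows "(\<lambda>N. measure (spiked_wigner P lam N)
            {Y \<in> space (spiked_wigner P lam N). 1 / real N * ln (likelihood_ratio P lam N Y) > 0})
          \<longlonglongrightarrow> 1 \<and>
         (\<lambda>N. measure (spiked_wigner P 0 N)
            {Y \<in> space (spiked_wigner P 0 N). 1 / real N * ln (likelihood_ratio P lam N Y) \<le> 0})
          \<longlonglongrightarrow> 1 \<and>
         asymptotically_orthogonal (spiked_wigner P lam) (spiked_wigner P 0)"
proof -
  obtain K where "bounded_prior P K"
    by (rule bounded_support_imp_bounded_prior[OF prior bounded_prior])
  then interpret P: bounded_prior P K .
  have "0 \<le> lambda_c P" unfolding lambda_c_def by (intro Sup_upper) auto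
  then have lam: "0 < lam" using above_threshold by (metis ereal_less(2) order_le_less_trans)
  \<comment> \<open>A positive \<open>lam\<close> at which \<open>phi_RS\<close> vanishes belongs to
    the set whose supremum is the threshold.\<close>
  have "phi_RS P lam \<noteq> 0"
  proof
    assume "phi_RS P lam = 0"
    then have "ereal lam \<le> lambda_c P" unfolding lambda_c_def using lam by (intro Sup_upper) auto
    then show False using above_threshold by simp
  qed
  \<comment> \<open>The potential is 0 at \<open>q = 0\<close>. A supremum that is nonnegative and
    nonzero is positive, so some \<open>q\<close> has positive potential.\<close>
  moreover have "0 \<le> phi_RS P lam"
  proof -
    interpret S: prob_space std_normal_distribution by (rule prob_space_std_normal)
    interpret PS: pair_prob_space P std_normal_distribution by standard
    have "RS_potential P lam 0 = 0" using P.prob_space by (simp add: RS_potential_def psi_def split_beta')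
    then have "0 = ereal (RS_potential P lam 0)" by simp
    also have "\<dots> \<le> phi_RS P lam" unfolding phi_RS_def by (intro SUP_upper) auto
    finally show ?thesis .
  qed
  ultimately have "0 < phi_RS P lam" by simp
  then obtain q where q: "0 \<le> q" "0 < RS_potential P lam q"
    unfolding phi_RS_def by (auto simp: less_SUP_iff)
  let ?F = "RS_potential P lam q"
  let ?L = "likelihood_ratio P lam"
  let ?S = "spiked_wigner P lam" and ?null = "spiked_wigner P 0"
  have lam0: "0 \<le> lam" using lam by simp
  note Lpos = P.likelihood_ratio_pos[OF lam0]
  note [measurable] = P.likelihood_ratio_measurable[OF lam0]
  have S0: "?null N = noise N" for N by (rule spiked_wigner_zero[OF P.prob_space_axioms])
  have dens: "?S N = density (noise N) (\<lambda>Y. ennreal (?L N Y))" for N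
    using spiked_wigner_density[OF prior bounded_prior lam0, of N] unfolding S0 .
  have sp: "space (?S N) = space (noise N)" and st: "sets (?S N) = sets (noise N)" for N
    unfolding dens by auto
  have prob0: "prob_space (noise N)" for N by (rule prob_space_gauss)
  have prob: "prob_space (?S N)" for N
  proof -
    have "emeasure (?S N) (space (?S N)) = (\<integral>\<^sup>+Y. ennreal (?L N Y) \<partial>noise N)"
      unfolding dens by (subst emeasure_density) (auto intro!: nn_integral_cong)
    then show ?thesis by (intro prob_spaceI) (simp add: P.nn_integral_likelihood_ratio[OF lam0])
  qed
  \<comment> \<open>For \<open>N > 0\<close> the event \<open>?A N\<close> says that the ratio
    exceeds 1; for \<open>N = 0\<close> it is empty, since division by 0 gives 0. \<open>?T\<close>
    is the lower tail that is negligible under the spiked law.\<close>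
  let ?A = "\<lambda>N. {Y \<in> space (noise N). 1 / real N * ln (?L N Y) > 0}"
  let ?T = "\<lambda>N. {Y \<in> space (noise N). ?L N Y \<le> exp (real N * (?F / 4))}"
  have A [measurable]: "?A N \<in> sets (noise N)" and T [measurable]: "?T N \<in> sets (noise N)" for N
    by measurable
  have tail: "(\<lambda>N. measure (?S N) (?T N)) \<longlonglongrightarrow> 0"
    using likelihood_ratio_lower_tail[OF prior bounded_prior lam q] by (simp add: sp)
  have one: "(\<lambda>N. measure (?S N) (?A N)) \<longlonglongrightarrow> 1"
  proof (rule tendsto_sandwich)
    show "\<forall>\<^sub>F N in sequentially. 1 - measure (?S N) (?T N) \<le> measure (?S N) (?A N)"
      using eventually_gt_at_top[of 0]
    proof eventually_elim
      case (elim N)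
      interpret SN: prob_space "?S N" by (rule prob)
      have "space (?S N) - ?T N \<subseteq> ?A N"
      proof
        fix Y assume Y: "Y \<in> space (?S N) - ?T N"
        have "1 \<le> exp (real N * (?F / 4))" using q(2) by simp
        moreover have "exp (real N * (?F / 4)) < ?L N Y" using Y unfolding sp by auto
        ultimately have "1 < ?L N Y" by (rule order_le_less_trans)
        then show "Y \<in> ?A N" using Y elim by (auto simp: sp)
      qed
      then have "measure (?S N) (space (?S N) - ?T N) \<le> measure (?S N) (?A N)"
        by (intro SN.finite_measure_mono) (auto simp: st A)
      then show ?case by (subst (asm) SN.prob_compl) (auto simp: st T)
    qed
    show "\<forall>\<^sub>F N in sequentially. measure (?S N) (?A N) \<le> 1"
      by (intro always_eventually allI prob_space.prob_le_1 prob)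
    show "(\<lambda>N. 1 - measure (?S N) (?T N)) \<longlonglongrightarrow> 1"
      using tendsto_diff[OF tendsto_const tail, of 1] by simp
  qed simp
  have zero: "(\<lambda>N. measure (noise N) (?A N)) \<longlonglongrightarrow> 0"
  proof (rule tendsto_sandwich[OF _ _ tendsto_const])
    show "\<forall>\<^sub>F N in sequentially. measure (noise N) (?A N)
        \<le> measure (?S N) (?T N) + 1 * exp (- (real N * (?F / 4)))"
    proof (intro always_eventually allI)
      fix N
      interpret G: prob_space "noise N" by (rule prob0)
      interpret SN: prob_space "?S N" by (rule prob)
      let ?d = "exp (- (real N * (?F / 4)))"
      have "emeasure (noise N) (?A N) = (\<integral>\<^sup>+Y. indicator (?A N) Y \<partial>noise N)" by simp
      \<comment> \<open>Split of \<open>?A N\<close> at \<open>?T N\<close>: inside,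
        \<open>1 \<le> ?L N Y\<close> passes from the null to the spiked law; outside,
        \<open>1 \<le> ?d * ?L N Y\<close>, and the ratio has mean one under the null law.\<close>
      also have "\<dots> \<le> (\<integral>\<^sup>+Y. ennreal (?L N Y) * indicator (?T N) Y + ennreal ?d * ennreal (?L N Y) \<partial>noise N)"
      proof (intro nn_integral_mono)
        fix Y
        show "indicator (?A N) Y \<le> ennreal (?L N Y) * indicator (?T N) Y + ennreal ?d * ennreal (?L N Y)"
        proof (cases "Y \<in> ?A N")
          case True
          then have L1: "1 < ?L N Y" using Lpos[of N Y] by (auto simp: zero_less_divide_iff)
          show ?thesis
          proof (cases "Y \<in> ?T N")
            case True
            have "1 \<le> ennreal (?L N Y)" using L1 by (simp flip: ennreal_1 add: ennreal_leI)
            then show ?thesis using True \<open>Y \<in> ?A N\<close> by (simp add: add_increasing2)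
          next
            case False
            then have "exp (real N * (?F / 4)) < ?L N Y" using \<open>Y \<in> ?A N\<close> by auto
            then have "?d * exp (real N * (?F / 4)) \<le> ?d * ?L N Y" by (intro mult_left_mono) auto
            then have "1 \<le> ?d * ?L N Y" by (simp add: exp_add[symmetric])
            then have "1 \<le> ennreal (?d * ?L N Y)" by (simp flip: ennreal_1 add: ennreal_leI)
            then show ?thesis using False \<open>Y \<in> ?A N\<close> by (simp add: ennreal_mult')
          qed
        qed simp
      qed
      also have "\<dots> = emeasure (?S N) (?T N) + ennreal ?d * emeasure (?S N) (space (?S N))"
        unfolding dens by (simp add: nn_integral_add nn_integral_cmult emeasure_density cong: nn_integral_cong)
      also have "\<dots> = ennreal (measure (?S N) (?T N) + 1 * ?d)"
        by (simp add: SN.emeasure_eq_measure SN.prob_space)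
      finally show "measure (noise N) (?A N) \<le> measure (?S N) (?T N) + 1 * ?d"
        by (simp add: G.emeasure_eq_measure ennreal_le_iff del: ennreal_plus)
    qed
    show "(\<lambda>N. measure (?S N) (?T N) + 1 * exp (- (real N * (?F / 4)))) \<longlonglongrightarrow> 0"
      using tendsto_add[OF tail exp_linear_decay_tendsto_0[of "?F / 4" 1]] q(2) by simp
  qed simp
  have "(\<lambda>N. measure (noise N) {Y \<in> space (noise N). 1 / real N * ln (?L N Y) \<le> 0}) \<longlonglongrightarrow> 1"
  proof -
    have "measure (noise N) {Y \<in> space (noise N). 1 / real N * ln (?L N Y) \<le> 0} = 1 - measure (noise N) (?A N)" for N
    proof -
      have "{Y \<in> space (noise N). 1 / real N * ln (?L N Y) \<le> 0} = space (noise N) - ?A N" by auto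
      then show ?thesis using prob_space.prob_compl[OF prob0 A] by simp
    qed
    then show ?thesis using tendsto_diff[OF tendsto_const zero, of 1] by simp
  qed
  \<comment> \<open>The events \<open>?A\<close> themselves separate the two laws.\<close>
  moreover have "asymptotically_orthogonal ?S ?null"
    unfolding asymptotically_orthogonal_def
    by (rule exI[of _ ?A]) (use one zero in \<open>auto simp: st S0 A\<close>)
  ultimately show ?thesis using one by (simp add: sp S0)
qed

end
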